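(* For positive integers $m,n$ let $D_{m,n}$ be the number of acyclic orientations of the complete $n$-partite graph with all parts of size $m$. For each integer $J\geq 1$ there are effectively computable rational constants $\gamma_1,\ldots,\gamma_J$ such that, for every fixed $C<\infty$, uniformly for $1\leq m\leq Cn^J$, $$D_{m,n}=(mn)!\exp\!\left(-\frac m2+\frac12+\sum_{j=1}^J\gamma_j\frac{m}{n^j}+O_{C,J}(n^{-1})\right).$$ The first constants are $$\gamma_1=-\frac5{24},\quad \gamma_2=-\frac18,\quad \gamma_3=-\frac{251}{2880},\quad \gamma_4=-\frac{19}{288},\quad \gamma_5=-\frac{19087}{362880}.$$
   Context: The asymptotic parameter is $n\to\infty$, with $m$ allowed to depend on $n$. $O_{C,J}(n^{-1})$ denotes a quantity bounded in absolute value by $K n^{-1}$ with $K$ depending only on $C$ and $J$. The constants $\gamma_j$ do not depend on $m$, $n$ or $C$. *)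

theory Defs
  imports Complex_Main
begin

text \<open>A finite simple graph is given by its set of edges, each edge being a two-element set.\<close>

definition complete_multipartite :: "nat \<Rightarrow> nat \<Rightarrow> (nat \<times> nat) set set" where
  "complete_multipartite m n =
     {{(i, a), (j, b)} | i a j b. i < n \<and> j < n \<and> a < m \<and> b < m \<and> i \<noteq> j}"

definition orientation :: "'a set set \<Rightarrow> ('a \<times> 'a) set \<Rightarrow> bool" where
  "orientation E R \<longleftrightarrow>
     (\<forall>(u, v) \<in> R. {u, v} \<in> E) \<and>
     (\<forall>u v. {u, v} \<in> E \<longrightarrow> ((u, v) \<in> R \<longleftrightarrow> (v, u) \<notin> R))"

definition num_acyclic_orientations :: "'a set set \<Rightarrow> nat" where
  "num_acyclic_orientations E = card {R. orientation E R \<and> acyclic R}"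

definition D :: "nat \<Rightarrow> nat \<Rightarrow> nat" where
  "D m n = num_acyclic_orientations (complete_multipartite m n)"

text \<open>
  Total recursive functions. In \<open>total_recursive n f\<close> the number \<open>n\<close> is the arity; only the
  values of \<open>f\<close> on lists of length \<open>n\<close> are meaningful. Minimisation is restricted to
  regular functions, so that every generated function is total.
\<close>

inductive total_recursive :: "nat \<Rightarrow> (nat list \<Rightarrow> nat) \<Rightarrow> bool" where
  zero: "total_recursive n (\<lambda>xs. 0)"
| succ: "total_recursive 1 (\<lambda>xs. Suc (hd xs))"
| proj: "i < n \<Longrightarrow> total_recursive n (\<lambda>xs. xs ! i)"
| comp: "total_recursive (length gs) f \<Longrightarrow> (\<And>g. g \<in> set gs \<Longrightarrow> total_recursive n g) \<Longrightarrow>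
    total_recursive n (\<lambda>xs. f (map (\<lambda>g. g xs) gs))"
| prim_rec: "total_recursive n f \<Longrightarrow> total_recursive (Suc (Suc n)) h \<Longrightarrow>
    total_recursive (Suc n)
      (\<lambda>xs. rec_nat (f (tl xs)) (\<lambda>k r. h (k # r # tl xs)) (hd xs))"
| minimise: "total_recursive (Suc n) f \<Longrightarrow>
    (\<And>xs. length xs = n \<Longrightarrow> \<exists>y. f (y # xs) = 0) \<Longrightarrow>
    total_recursive n (\<lambda>xs. LEAST y. f (y # xs) = 0)"

definition computable_nat_seq :: "(nat \<Rightarrow> nat) \<Rightarrow> bool" where
  "computable_nat_seq g \<longleftrightarrow> (\<exists>f. total_recursive 1 f \<and> (\<forall>k. g k = f [k]))"

definition computable_rat_seq :: "(nat \<Rightarrow> rat) \<Rightarrow> bool" where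
  "computable_rat_seq r \<longleftrightarrow>
     (\<exists>s a b. computable_nat_seq s \<and> computable_nat_seq a \<and> computable_nat_seq b \<and>
        (\<forall>k. b k \<noteq> 0 \<and> r k = (-1) ^ s k * of_nat (a k) / of_nat (b k)))"

end

theory Submission
  imports Defs "HOL-Probability.Distributions" "HOL-Combinatorics.Stirling" "HOL-Real_Asymp.Real_Asymp"
begin

text \<open>
  Let \<open>P_m\<close> be the signed Touchard polynomial. Inclusion-exclusion over the set of sources gives
  a recursion for the number of acyclic orientations which is also satisfied by
  \<open>\<integral> exp (-s) * P_m(s)^n ds\<close>, the integral being over \<open>[0, \<infinity>)\<close>. All roots of \<open>P_m\<close> are
  real and lie in \<open>[0, 6 m]\<close>; this forces \<open>P_m\<close> to be so close to a shifted power
  \<open>\<kappa> * (s - d)^m\<close> that \<open>\<integral> exp (-k s / n) * P_m(s)^k ds\<close> is \<open>a^k\<close> times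
  the Gamma integral \<open>\<integral> exp (-k s / n) * s^(m k) ds\<close> up to a factor \<open>1 + O(1 / n^2)\<close>, with
  \<open>a\<close> independent of \<open>k\<close>. The case \<open>k = n\<close> is the number sought, and the case \<open>k = 1\<close>
  determines \<open>a\<close>: there the integral equals \<open>\<Sum>j. j^m * (1 - 1 / n)^(j - 1)\<close>, which the trapezoid
  rule evaluates as \<open>m! / ((1 - 1 / n) * L^(m + 1))\<close> with \<open>L = - ln (1 - 1 / n)\<close>, again up to
  \<open>1 + O(1 / n^2)\<close>. Hence \<open>D m n\<close> is \<open>(m n)! * exp (n L) * (n L)^(- (m + 1) n)\<close> up to
  \<open>1 + O(1 / n)\<close>, uniformly in \<open>m\<close>, and the expansion of \<open>ln (n L)\<close> in powers of \<open>1 / n\<close>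
  supplies the constants.
\<close>

section \<open>Acyclic orientations of complete multipartite graphs\<close>

text \<open>The weight \<open>exp (- k s / n) * s^(m k)\<close> peaks at s = m n for every k. This
  is why the rate is k / n: one expansion point, and hence one shift \<open>d\<close> and one
  constant \<open>\<kappa>\<close>, serves k = 1 and k = n alike. Since a enters D with exponent n,
  the case k = 1 has to be accurate to order n^-2, uniformly in m. An expansion in large m would
  fail for bounded m; Gamma integrals are exact for every m, so only the deviation of the product
  over the roots from a pure power needs an estimate. It is of second order in 1/v - 1/(m n). The
  range v <= 12 m, where the product may change sign, is negligible because the peak lies at m n. In
  the exponent, n L is close to 1 and (m + 1) n ln (n L) is close to (m + 1) / 2, whence the terms -
  m/2 + 1/2. The derivative of ln (- ln (1 - z) / z) is 1 / ((1 - z) L) - 1 / z, where L = - ln (1 -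
  z) and z L^-1 / (1 - z) is the generating function of the Adams-Bashforth coefficients 1, 1/2,
  5/12, 3/8, 251/720, ...; dividing them by their index and changing the sign gives the constants.
  The second-order estimates need m >= 2; for m = 1 the graph is complete.\<close>

definition multipartite_on :: "('a \<times> 'b) set \<Rightarrow> ('a \<times> 'b) set set" where
  "multipartite_on V = {{u, v} |u v. u \<in> V \<and> v \<in> V \<and> fst u \<noteq> fst v}"

text \<open>The vertex set is arbitrary, with the fibres of \<open>fst\<close> as parts, because
  deleting sources destroys the equality of the part sizes.\<close>

definition acyc_orients :: "('a \<times> 'b) set \<Rightarrow> (('a \<times> 'b) \<times> ('a \<times> 'b)) set set" where
  "acyc_orients V = {R. orientation (multipartite_on V) R \<and> acyclic R}"

definition sources :: "('a \<times> 'b) set \<Rightarrow> (('a \<times> 'b) \<times> ('a \<times> 'b)) set \<Rightarrow> ('a \<times> 'b) set" where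
  "sources V R = {v \<in> V. \<forall>u. (u, v) \<notin> R}"

lemma doubleton_in_multipartite_on:
  "{u, v} \<in> multipartite_on V \<longleftrightarrow> u \<in> V \<and> v \<in> V \<and> fst u \<noteq> fst v"
  unfolding multipartite_on_def mem_Collect_eq doubleton_eq_iff by metis

lemma orientation_multipartite_on:
  "orientation (multipartite_on V) R \<longleftrightarrow>
     (\<forall>u v. (u, v) \<in> R \<longrightarrow> u \<in> V \<and> v \<in> V \<and> fst u \<noteq> fst v) \<and>
     (\<forall>u v. u \<in> V \<and> v \<in> V \<and> fst u \<noteq> fst v \<longrightarrow> ((u, v) \<in> R \<longleftrightarrow> (v, u) \<notin> R))"
proof -
  have "(\<forall>(u, v)\<in>R. Q u v) \<longleftrightarrow> (\<forall>u v. (u, v) \<in> R \<longrightarrow> Q u v)" for Q by blast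
  then show ?thesis
    unfolding orientation_def doubleton_in_multipartite_on by simp
qed

lemma multipartite_on_eq_complete_multipartite:
  "multipartite_on ({..<n} \<times> {..<m}) = complete_multipartite m n"
  unfolding multipartite_on_def complete_multipartite_def by fastforce

lemma finite_acyc_orients: "finite V \<Longrightarrow> finite (acyc_orients V)"
  by (rule finite_subset[of _ "Pow (V \<times> V)"])
     (auto simp: acyc_orients_def orientation_multipartite_on)

lemma finite_acyc_orient: "finite V \<Longrightarrow> R \<in> acyc_orients V \<Longrightarrow> finite R"
  by (rule finite_subset[of _ "V \<times> V"]) (auto simp: acyc_orients_def orientation_multipartite_on)

lemma sources_nonempty:
  assumes "finite V" "V \<noteq> {}" "R \<in> acyc_orients V"
  shows "sources V R \<noteq> {}"
proof -
  have "finite R" using finite_acyc_orient assms by blast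
  moreover have "acyclic R" using assms(3) by (simp add: acyc_orients_def)
  ultimately have "wf R" by (rule finite_acyclic_wf)
  then obtain v where "v \<in> V" "\<And>u. (u, v) \<in> R \<Longrightarrow> u \<notin> V"
    using assms(2) unfolding wf_eq_minimal by blast
  moreover have "\<And>u. (u, v) \<in> R \<Longrightarrow> u \<in> V"
    using assms(3) unfolding acyc_orients_def orientation_multipartite_on by blast
  ultimately have "v \<in> sources V R" unfolding sources_def by blast
  then show ?thesis by blast
qed

text \<open>Vertices of different parts are adjacent, and the edge between them enters one of the
  two.\<close>

lemma sources_same_part:
  assumes "R \<in> acyc_orients V" "u \<in> sources V R" "v \<in> sources V R"
  shows "fst u = fst v"
  using assms unfolding sources_def acyc_orients_def orientation_multipartite_on by blast

text \<open>No edge enters \<open>S\<close>, so a path can use an edge of \<open>T\<close> only as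
  its first step; a cycle would lie entirely in \<open>R\<close>.\<close>

lemma acyclic_Un_no_edges_into:
  assumes "acyclic R" "\<And>x y. (x, y) \<in> R \<Longrightarrow> x \<notin> S \<and> y \<notin> S"
    "\<And>x y. (x, y) \<in> T \<Longrightarrow> x \<in> S \<and> y \<notin> S"
  shows "acyclic (R \<union> T)"
proof -
  have path: "(x, y) \<in> R\<^sup>+ \<and> x \<notin> S \<or> x \<in> S \<and> y \<notin> S" if "(x, y) \<in> (R \<union> T)\<^sup>+" for x y
    using that
  proof induction
    case (base y)
    then show ?case using assms by blast
  next
    case (step y z)
    have R: "\<And>x y. (x, y) \<in> R\<^sup>+ \<Longrightarrow> y \<notin> S"
      using assms(2) by (meson tranclE)
    show ?case
    proof (cases "(y, z) \<in> R")
      case True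
      then show ?thesis using step.IH assms(2)[OF True] by (meson trancl_into_trancl)
    next
      case False
      then have "y \<in> S" "z \<notin> S" using step.hyps assms(3) by blast+
      then show ?thesis using step.IH R by blast
    qed
  qed
  show ?thesis unfolding acyclic_def using path assms(1) by (metis acyclic_def)
qed

text \<open>If all of \<open>S\<close> are sources, every edge at \<open>S\<close> must point away
  from it, and what remains is an arbitrary acyclic orientation of \<open>V - S\<close>. The inverse
  map adds the forced edges \<open>T\<close>. As \<open>S\<close> lies in one part, no edge joins
  two of its vertices.\<close>

lemma card_acyc_orients_sources_superset:
  assumes "S \<subseteq> V" "\<And>u v. u \<in> S \<Longrightarrow> v \<in> S \<Longrightarrow> fst u = fst v"
  shows "card {R \<in> acyc_orients V. S \<subseteq> sources V R} = card (acyc_orients (V - S))"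
proof (rule bij_betw_same_card[of "\<lambda>R. R - S \<times> UNIV"])
  define T where "T = {(u, v). u \<in> S \<and> v \<in> V \<and> fst u \<noteq> fst v}"
  show "bij_betw (\<lambda>R. R - S \<times> UNIV) {R \<in> acyc_orients V. S \<subseteq> sources V R} (acyc_orients (V - S))"
  proof (rule bij_betw_byWitness[where f' = "\<lambda>R. R \<union> T"])
    show "\<forall>R\<in>{R \<in> acyc_orients V. S \<subseteq> sources V R}. R - S \<times> UNIV \<union> T = R"
    proof
      fix R assume R: "R \<in> {R \<in> acyc_orients V. S \<subseteq> sources V R}"
      then have o: "orientation (multipartite_on V) R" and s: "S \<subseteq> sources V R"
        by (auto simp: acyc_orients_def)
      have "T \<subseteq> R"
        using o s assms(1) unfolding T_def orientation_multipartite_on sources_def by blast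
      moreover have "R \<inter> S \<times> UNIV \<subseteq> T"
        using o unfolding T_def orientation_multipartite_on by blast
      ultimately show "R - S \<times> UNIV \<union> T = R" by blast
    qed
    show "\<forall>R\<in>acyc_orients (V - S). R \<union> T - S \<times> UNIV = R"
    proof
      fix R assume "R \<in> acyc_orients (V - S)"
      then have "R \<inter> S \<times> UNIV = {}"
        unfolding acyc_orients_def orientation_multipartite_on by blast
      moreover have "T \<subseteq> S \<times> UNIV" by (auto simp: T_def)
      ultimately show "R \<union> T - S \<times> UNIV = R" by blast
    qed
    show "(\<lambda>R. R - S \<times> UNIV) ` {R \<in> acyc_orients V. S \<subseteq> sources V R} \<subseteq> acyc_orients (V - S)"
    proof clarify
      fix R assume "R \<in> acyc_orients V" and s: "S \<subseteq> sources V R"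
      then have o: "orientation (multipartite_on V) R" and a: "acyclic R"
        by (auto simp: acyc_orients_def)
      have "orientation (multipartite_on (V - S)) (R - S \<times> UNIV)"
        using o s unfolding orientation_multipartite_on sources_def by blast
      moreover have "acyclic (R - S \<times> UNIV)" using a by (rule acyclic_subset) auto
      ultimately show "R - S \<times> UNIV \<in> acyc_orients (V - S)" by (simp add: acyc_orients_def)
    qed
    show "(\<lambda>R. R \<union> T) ` acyc_orients (V - S) \<subseteq> {R \<in> acyc_orients V. S \<subseteq> sources V R}"
    proof clarify
      fix R assume "R \<in> acyc_orients (V - S)"
      then have o: "orientation (multipartite_on (V - S)) R" and a: "acyclic R"
        by (auto simp: acyc_orients_def)
      have R: "\<And>x y. (x, y) \<in> R \<Longrightarrow> x \<notin> S \<and> y \<notin> S"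
        using o unfolding orientation_multipartite_on by blast
      have T: "\<And>x y. (x, y) \<in> T \<Longrightarrow> x \<in> S \<and> y \<notin> S"
        using assms(2) unfolding T_def by blast
      have "acyclic (R \<union> T)" using a R T by (rule acyclic_Un_no_edges_into)
      moreover have "orientation (multipartite_on V) (R \<union> T)"
        unfolding orientation_multipartite_on
      proof (intro conjI allI impI)
        fix u v assume uv: "u \<in> V \<and> v \<in> V \<and> fst u \<noteq> fst v"
        show "((u, v) \<in> R \<union> T) = ((v, u) \<notin> R \<union> T)"
        proof (cases "u \<in> S \<or> v \<in> S")
          case True
          then show ?thesis using uv R[of u v] R[of v u] assms(2)[of u v] by (auto simp: T_def)
        next
          case False
          then have "u \<in> V - S" "v \<in> V - S" using uv by auto
          then have "(u, v) \<in> R \<longleftrightarrow> (v, u) \<notin> R"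
            using o uv unfolding orientation_multipartite_on by blast
          then show ?thesis using False by (auto simp: T_def)
        qed
      next
        fix u v assume "(u, v) \<in> R \<union> T"
        then show "u \<in> V" "v \<in> V" "fst u \<noteq> fst v"
          using o assms(1) unfolding orientation_multipartite_on T_def by blast+
      qed
      moreover have "S \<subseteq> sources V (R \<union> T)"
        using R T assms(1) unfolding sources_def by blast
      ultimately show "R \<union> T \<in> acyc_orients V \<and> S \<subseteq> sources V (R \<union> T)"
        by (simp add: acyc_orients_def)
    qed
  qed
qed

section \<open>Inclusion-exclusion over sets of sources\<close>

lemma sum_Pow_alternating:
  "finite X \<Longrightarrow> X \<noteq> {} \<Longrightarrow> (\<Sum>S\<in>Pow X. (-1 :: 'a :: comm_ring_1) ^ card S) = 0"
proof (induction X rule: finite_induct)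
  case (insert x X)
  have inj: "inj_on (insert x) (Pow X)"
    using insert.hyps(2) by (auto simp: inj_on_def)
  have "(\<Sum>S\<in>Pow (insert x X). (-1 :: 'a) ^ card S)
      = (\<Sum>S\<in>Pow X. (-1) ^ card S) + (\<Sum>S\<in>insert x ` Pow X. (-1) ^ card S)"
    unfolding Pow_insert using insert.hyps by (intro sum.union_disjoint) auto
  also have "(\<Sum>S\<in>insert x ` Pow X. (-1 :: 'a) ^ card S) = (\<Sum>S\<in>Pow X. - ((-1) ^ card S))"
    unfolding sum.reindex[OF inj]
  proof (rule sum.cong[OF refl])
    fix S assume "S \<in> Pow X"
    then have "finite S" "x \<notin> S" using insert.hyps finite_subset by auto
    then show "((\<lambda>S. (-1 :: 'a) ^ card S) \<circ> insert x) S = - ((-1) ^ card S)" by simp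
  qed
  finally show ?case by (simp add: sum_negf)
qed simp

lemma sum_nonempty_subsets_alternating:
  assumes "finite X" "X \<noteq> {}"
  shows "(\<Sum>S\<in>Pow X - {{}}. (-1 :: 'a :: comm_ring_1) ^ (card S + 1)) = 1"
proof -
  have "0 = (\<Sum>S\<in>Pow X. (-1 :: 'a) ^ card S)" using sum_Pow_alternating[OF assms] by simp
  also have "\<dots> = 1 + (\<Sum>S\<in>Pow X - {{}}. (-1 :: 'a) ^ card S)"
    using assms(1) by (subst sum.remove[of _ "{}"]) auto
  finally have "(\<Sum>S\<in>Pow X - {{}}. (-1 :: 'a) ^ card S) = -1"
    by (simp add: eq_neg_iff_add_eq_0 add.commute)
  then show ?thesis by (simp add: sum_negf)
qed

text \<open>Each orientation is counted as 1 = the alternating sum over nonempty sets of its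
  sources, and the two sums are exchanged. Such a set lies in a single part, and being nonempty it
  determines that part, so the sum splits over the parts.\<close>

lemma card_acyc_orients_rec:
  assumes fin: "finite V" and ne: "V \<noteq> {}"
  shows "real (card (acyc_orients V)) =
    (\<Sum>i\<in>fst ` V. \<Sum>S\<in>Pow {v \<in> V. fst v = i} - {{}}.
       (-1) ^ (card S + 1) * real (card (acyc_orients (V - S))))"
proof -
  define \<S> where "\<S> = (\<Union>i\<in>fst ` V. Pow {v \<in> V. fst v = i} - {{}})"
  have fS: "finite \<S>" unfolding \<S>_def using fin by auto
  have src: "Pow (sources V R) - {{}} = {S \<in> \<S>. S \<subseteq> sources V R}" if R: "R \<in> acyc_orients V" for R
  proof -
    have sub: "sources V R \<subseteq> V" by (auto simp: sources_def)
    have "S \<in> \<S>" if S: "S \<subseteq> sources V R" "S \<noteq> {}" for S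
    proof -
      obtain s where s: "s \<in> S" using S(2) by blast
      have "S \<subseteq> {v \<in> V. fst v = fst s}"
        using S(1) sub sources_same_part[OF R] s by blast
      moreover have "s \<in> V" using s S(1) sub by blast
      ultimately show ?thesis using S(2) unfolding \<S>_def by blast
    qed
    moreover have "{} \<notin> \<S>" by (auto simp: \<S>_def)
    ultimately show ?thesis by blast
  qed
  have "real (card (acyc_orients V)) = (\<Sum>R\<in>acyc_orients V. 1)" by simp
  also have "\<dots> = (\<Sum>R\<in>acyc_orients V. \<Sum>S\<in>Pow (sources V R) - {{}}. (-1) ^ (card S + 1))"
  proof (rule sum.cong[OF refl])
    fix R assume R: "R \<in> acyc_orients V"
    have "finite (sources V R)" using fin by (auto simp: sources_def)
    then show "1 = (\<Sum>S\<in>Pow (sources V R) - {{}}. (-1 :: real) ^ (card S + 1))"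
      using sum_nonempty_subsets_alternating sources_nonempty[OF fin ne R] by metis
  qed
  also have "\<dots> = (\<Sum>R\<in>acyc_orients V. \<Sum>S | S \<in> \<S> \<and> S \<subseteq> sources V R. (-1) ^ (card S + 1))"
    by (intro sum.cong refl) (use src in auto)
  also have "\<dots> = (\<Sum>S\<in>\<S>. \<Sum>R | R \<in> acyc_orients V \<and> S \<subseteq> sources V R. (-1) ^ (card S + 1))"
    using finite_acyc_orients[OF fin] fS by (rule sum.swap_restrict)
  also have "\<dots> = (\<Sum>S\<in>\<S>. (-1) ^ (card S + 1) * real (card (acyc_orients (V - S))))"
  proof (rule sum.cong[OF refl])
    fix S assume "S \<in> \<S>"
    then obtain i where "S \<subseteq> {v \<in> V. fst v = i}" unfolding \<S>_def by blast
    then have "card {R \<in> acyc_orients V. S \<subseteq> sources V R} = card (acyc_orients (V - S))"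
      by (intro card_acyc_orients_sources_superset) blast+
    then show "(\<Sum>R | R \<in> acyc_orients V \<and> S \<subseteq> sources V R. (-1) ^ (card S + 1)) =
        (-1) ^ (card S + 1) * real (card (acyc_orients (V - S)))" by simp
  qed
  also have "\<dots> = (\<Sum>i\<in>fst ` V. \<Sum>S\<in>Pow {v \<in> V. fst v = i} - {{}}.
       (-1) ^ (card S + 1) * real (card (acyc_orients (V - S))))"
    unfolding \<S>_def
  proof (rule sum.UNION_disjoint)
    show "\<forall>i\<in>fst ` V. \<forall>j\<in>fst ` V. i \<noteq> j \<longrightarrow>
        (Pow {v \<in> V. fst v = i} - {{}}) \<inter> (Pow {v \<in> V. fst v = j} - {{}}) = {}"
    proof (intro ballI impI equals0I)
      fix i j S
      assume "i \<noteq> j" "S \<in> (Pow {v \<in> V. fst v = i} - {{}}) \<inter> (Pow {v \<in> V. fst v = j} - {{}})"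
      then show False by (metis (mono_tags, lifting) DiffE IntE Pow_iff ex_in_conv mem_Collect_eq singletonI subsetD)
    qed
  qed (use fin in auto)
  finally show ?thesis .
qed

lemma acyc_orients_empty: "acyc_orients {} = {{}}"
  by (auto simp: acyc_orients_def orientation_multipartite_on acyclic_def)

lemma D_eq_card_acyc_orients: "D m n = card (acyc_orients ({..<n} \<times> {..<m}))"
  by (simp add: D_def num_acyclic_orientations_def acyc_orients_def multipartite_on_eq_complete_multipartite)

text \<open>Needed for taking \<open>ln (D m n)\<close>. The witness directs every edge towards the
  larger part index.\<close>

lemma D_pos: "D m n > 0"
proof -
  let ?V = "{..<n} \<times> {..<m}"
  define R where "R = {(u, v). u \<in> ?V \<and> v \<in> ?V \<and> fst u < fst v}"
  have "R \<subseteq> inv_image less_than fst" by (auto simp: R_def)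
  then have "acyclic R" by (meson wf_acyclic wf_inv_image wf_less_than wf_subset)
  moreover have "orientation (multipartite_on ?V) R"
    unfolding orientation_multipartite_on R_def by auto
  ultimately have "R \<in> acyc_orients ?V" by (simp add: acyc_orients_def)
  then show ?thesis
    unfolding D_eq_card_acyc_orients using finite_acyc_orients[of ?V] by (auto simp: card_gt_0_iff)
qed

section \<open>Signed Touchard polynomials\<close>

lemma pderiv_sum: "pderiv (\<Sum>i\<in>A. f i) = (\<Sum>i\<in>A. pderiv (f i))"
  by (induction A rule: infinite_finite_induct) (auto simp: pderiv_add)

text \<open>The signed Touchard polynomial \<open>\<Sum>k. (-1)^(m - k) S(m,k) x^k\<close>, with Stirling numbers of the second kind \<open>S(m,k)\<close>.\<close>

primrec stouchard :: "nat \<Rightarrow> real poly" where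
  "stouchard 0 = 1"
| "stouchard (Suc m) = [:0, 1:] * (stouchard m - pderiv (stouchard m))"

text \<open>Umbrally this is (P - 1)^m, where P^j stands for \<open>stouchard j\<close>.\<close>

definition stouchard_diff :: "nat \<Rightarrow> real poly" where
  "stouchard_diff m = (\<Sum>k\<le>m. smult ((-1) ^ k * real (m choose k)) (stouchard (m - k)))"

text \<open>Pascal's rule; umbrally, (P - 1)^(m+1) = P (P - 1)^m - (P - 1)^m.\<close>

lemma stouchard_diff_Suc:
  "stouchard_diff (Suc m) =
    (\<Sum>k\<le>m. smult ((-1) ^ k * real (m choose k)) (stouchard (Suc (m - k)))) - stouchard_diff m"
proof -
  let ?t = "\<lambda>k. smult ((-1) ^ k * real (m choose k)) (stouchard (Suc m - k))"
  have "stouchard_diff (Suc m) = stouchard (Suc m) +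
      (\<Sum>k\<le>m. smult ((-1) ^ Suc k * real (Suc m choose Suc k)) (stouchard (m - k)))"
    unfolding stouchard_diff_def by (subst sum.atMost_Suc_shift) simp
  also have "(\<Sum>k\<le>m. smult ((-1) ^ Suc k * real (Suc m choose Suc k)) (stouchard (m - k))) =
      (\<Sum>k\<le>m. ?t (Suc k)) - stouchard_diff m"
    unfolding stouchard_diff_def sum_subtractf[symmetric]
    by (intro sum.cong refl)
       (simp add: algebra_simps smult_add_left[symmetric] smult_diff_left[symmetric] del: stouchard.simps)
  also have "(\<Sum>k\<le>m. ?t (Suc k)) = (\<Sum>k\<le>Suc m. ?t k) - ?t 0"
    by (simp add: sum.atMost_Suc_shift del: sum.atMost_Suc stouchard.simps)
  also have "(\<Sum>k\<le>Suc m. ?t k) = (\<Sum>k\<le>m. smult ((-1) ^ k * real (m choose k)) (stouchard (Suc (m - k))))"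
    by (simp add: Suc_diff_le del: stouchard.simps)
  finally show ?thesis by (simp del: stouchard.simps)
qed

text \<open>The exponential generating function of the polynomials is exp (x (1 - e^-t)), and
  differentiating in x multiplies it by 1 - e^-t. The proof stays with polynomials: by induction
  \<open>stouchard (Suc j)\<close> is x times \<open>stouchard_diff j\<close>, and the product rule
  is applied to this factorization.\<close>

lemma pderiv_stouchard: "pderiv (stouchard m) = stouchard m - stouchard_diff m"
proof (induction m rule: less_induct)
  case (less m)
  show ?case
  proof (cases m)
    case 0
    then show ?thesis by (simp add: stouchard_diff_def)
  next
    case (Suc m')
    define E where "E = stouchard_diff m'"
    have P: "stouchard (Suc j) = [:0, 1:] * stouchard_diff j" if "j \<le> m'" for j
      using less.IH[of j] that Suc by simp
    have "pderiv E = (\<Sum>k\<le>m'. smult ((-1) ^ k * real (m' choose k))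
        (stouchard (m' - k) - stouchard_diff (m' - k)))"
      unfolding E_def stouchard_diff_def[of m'] pderiv_sum pderiv_smult
      using less.IH Suc by (intro sum.cong refl) simp
    then have "[:0, 1:] * pderiv E = [:0, 1:] * E -
        (\<Sum>k\<le>m'. smult ((-1) ^ k * real (m' choose k)) ([:0, 1:] * stouchard_diff (m' - k)))"
      unfolding E_def stouchard_diff_def[of m']
      by (simp add: sum_subtractf smult_diff_right right_diff_distrib sum_distrib_left)
    also have "(\<Sum>k\<le>m'. smult ((-1) ^ k * real (m' choose k)) ([:0, 1:] * stouchard_diff (m' - k))) =
        (\<Sum>k\<le>m'. smult ((-1) ^ k * real (m' choose k)) (stouchard (Suc (m' - k))))"
      by (intro sum.cong refl) (simp add: P del: stouchard.simps)
    also have "\<dots> = stouchard_diff (Suc m') + E"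
      by (simp add: stouchard_diff_Suc E_def)
    finally have "[:0, 1:] * pderiv E + E = [:0, 1:] * E - stouchard_diff (Suc m')" by simp
    moreover have "pderiv (stouchard (Suc m')) = [:0, 1:] * pderiv E + E"
      unfolding P[OF order_refl] E_def pderiv_mult by (simp add: pderiv_pCons)
    ultimately show ?thesis using Suc P[OF order_refl] by (simp add: E_def del: stouchard.simps)
  qed
qed

lemma stouchard_Suc: "stouchard (Suc m) = [:0, 1:] * stouchard_diff m"
  by (simp add: pderiv_stouchard)

lemma stouchard_diff_subsets:
  assumes "finite X"
  shows "stouchard_diff (card X) = (\<Sum>S\<in>Pow X. smult ((-1) ^ card S) (stouchard (card (X - S))))"
proof -
  have "(\<Sum>S\<in>Pow X. smult ((-1) ^ card S) (stouchard (card (X - S)))) =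
      (\<Sum>S\<in>Pow X. smult ((-1) ^ card S) (stouchard (card X - card S)))"
    using assms by (intro sum.cong refl) (auto simp: card_Diff_subset finite_subset)
  also have "\<dots> = (\<Sum>k\<le>card X. \<Sum>S | S \<in> Pow X \<and> card S = k. smult ((-1) ^ card S) (stouchard (card X - card S)))"
    using assms by (intro sum.group[symmetric]) (auto intro: card_mono)
  also have "\<dots> = stouchard_diff (card X)"
    unfolding stouchard_diff_def
    using n_subsets[OF assms] by (intro sum.cong refl) (simp add: Pow_def mult_ac of_nat_poly)
  finally show ?thesis ..
qed

text \<open>Brings the derivative into the shape of one inner sum of
  \<open>card_acyc_orients_rec\<close>: a signed sum over the nonempty sets removed from one
  part.\<close>

lemma pderiv_stouchard_subsets:
  assumes "finite X"
  shows "pderiv (stouchard (card X)) =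
    (\<Sum>S\<in>Pow X - {{}}. smult ((-1) ^ (card S + 1)) (stouchard (card (X - S))))"
proof -
  have "stouchard_diff (card X) = stouchard (card X) +
      (\<Sum>S\<in>Pow X - {{}}. smult ((-1) ^ card S) (stouchard (card (X - S))))"
    unfolding stouchard_diff_subsets[OF assms] using assms by (subst sum.remove[of _ "{}"]) auto
  then show ?thesis by (simp add: pderiv_stouchard sum_negf)
qed

text \<open>The integral of exp (- y s) p(s) over s >= 0, given through coefficients so that the
  counting identity is pure algebra. \<open>has_bochner_integral_laplace_poly\<close> supplies the
  link to the integral.\<close>

definition laplace_poly :: "real \<Rightarrow> real poly \<Rightarrow> real" where
  "laplace_poly y p = (\<Sum>k\<le>degree p. coeff p k * fact k / y ^ Suc k)"

lemma laplace_poly_altdef: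
  assumes "degree p \<le> n"
  shows "laplace_poly y p = (\<Sum>k\<le>n. coeff p k * fact k / y ^ Suc k)"
  unfolding laplace_poly_def using assms
  by (intro sum.mono_neutral_left) (auto simp: coeff_eq_0)

lemma laplace_poly_add: "laplace_poly y (p + q) = laplace_poly y p + laplace_poly y q"
proof -
  let ?n = "max (degree p) (degree q)"
  show ?thesis
    using degree_add_le_max[of p q]
    by (simp add: laplace_poly_altdef[of _ ?n] sum.distrib[symmetric] add_divide_distrib distrib_right)
qed

lemma laplace_poly_smult: "laplace_poly y (smult c p) = c * laplace_poly y p"
  using degree_smult_le[of c p]
  by (simp add: laplace_poly_altdef[of _ "degree p"] sum_distrib_left mult.assoc)

lemma laplace_poly_0 [simp]: "laplace_poly y 0 = 0"
  by (simp add: laplace_poly_def)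

lemma laplace_poly_sum: "laplace_poly y (\<Sum>i\<in>A. f i) = (\<Sum>i\<in>A. laplace_poly y (f i))"
  by (induction A rule: infinite_finite_induct) (auto simp: laplace_poly_add)

text \<open>Integration by parts at rate 1.\<close>

lemma laplace_poly_pderiv: "laplace_poly 1 (pderiv p) = laplace_poly 1 p - poly p 0"
proof -
  define n where "n = degree p"
  have "laplace_poly 1 (pderiv p) = (\<Sum>k\<le>n. coeff p (Suc k) * fact (Suc k))"
    unfolding n_def using degree_pderiv[of p]
    by (subst laplace_poly_altdef[of _ "degree p"]) (auto simp: coeff_pderiv mult_ac intro!: sum.cong)
  also have "\<dots> = (\<Sum>k\<le>Suc n. coeff p k * fact k) - coeff p 0"
    by (simp add: sum.atMost_Suc_shift del: sum.atMost_Suc fact_Suc)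
  also have "(\<Sum>k\<le>Suc n. coeff p k * fact k) = laplace_poly 1 p"
    by (subst laplace_poly_altdef[of _ "Suc n"]) (auto simp: n_def)
  finally show ?thesis by (simp add: poly_0_coeff_0)
qed

text \<open>Both sides obey the same recursion: by the product rule the sum over parts in
  \<open>card_acyc_orients_rec\<close> becomes the derivative of the whole product, and the
  transform at rate 1 does not see the derivative of a polynomial vanishing at 0. The index set
  \<open>I\<close> is kept fixed while parts run empty; an empty part contributes the factor
  1.\<close>

lemma card_acyc_orients_eq_laplace_poly:
  assumes "finite I" "finite V" "fst ` V \<subseteq> I"
  shows "real (card (acyc_orients V)) =
    laplace_poly 1 (\<Prod>i\<in>I. stouchard (card {v \<in> V. fst v = i}))"
  using assms(2,3)
proof (induction "card V" arbitrary: V rule: less_induct)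
  case less
  define Q where "Q = (\<lambda>V :: ('a \<times> 'b) set. \<Prod>i\<in>I. stouchard (card {v \<in> V. fst v = i}))"
  show ?case
  proof (cases "V = {}")
    case True
    then show ?thesis by (simp add: acyc_orients_empty laplace_poly_def)
  next
    case False
    have Q: "Q (V - S) = stouchard (card ({v \<in> V. fst v = i} - S)) *
        (\<Prod>j\<in>I - {i}. stouchard (card {v \<in> V. fst v = j}))"
      if "i \<in> I" "S \<subseteq> {v \<in> V. fst v = i}" for i S
    proof -
      have "{v \<in> V - S. fst v = i} = {v \<in> V. fst v = i} - S" by blast
      moreover have "{v \<in> V - S. fst v = j} = {v \<in> V. fst v = j}" if "j \<noteq> i" for j
        using that \<open>S \<subseteq> _\<close> by blast
      ultimately show ?thesis
        unfolding Q_def prod.remove[OF assms(1) that(1)] by (auto intro!: prod.cong)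
    qed
    have "real (card (acyc_orients V)) =
      (\<Sum>i\<in>fst ` V. \<Sum>S\<in>Pow {v \<in> V. fst v = i} - {{}}.
         (-1) ^ (card S + 1) * real (card (acyc_orients (V - S))))"
      using less.prems(1) False by (rule card_acyc_orients_rec)
    also have "\<dots> = (\<Sum>i\<in>I. \<Sum>S\<in>Pow {v \<in> V. fst v = i} - {{}}.
         (-1) ^ (card S + 1) * real (card (acyc_orients (V - S))))"
    proof (rule sum.mono_neutral_left[OF assms(1) less.prems(2)], rule ballI)
      fix i assume "i \<in> I - fst ` V"
      then have "{v \<in> V. fst v = i} = {}" by blast
      then show "(\<Sum>S\<in>Pow {v \<in> V. fst v = i} - {{}}.
         (-1) ^ (card S + 1) * real (card (acyc_orients (V - S)))) = 0" by (simp only: Pow_empty Diff_cancel sum.empty)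
    qed
    also have "\<dots> = (\<Sum>i\<in>I. \<Sum>S\<in>Pow {v \<in> V. fst v = i} - {{}}.
         laplace_poly 1 (smult ((-1) ^ (card S + 1)) (stouchard (card ({v \<in> V. fst v = i} - S))) *
           (\<Prod>j\<in>I - {i}. stouchard (card {v \<in> V. fst v = j}))))"
    proof (intro sum.cong refl)
      fix i S assume i: "i \<in> I" and S: "S \<in> Pow {v \<in> V. fst v = i} - {{}}"
      then have sub: "V - S \<subset> V" by blast
      then have "real (card (acyc_orients (V - S))) = laplace_poly 1 (Q (V - S))"
        unfolding Q_def using less.prems
        by (intro less.hyps psubset_card_mono) auto
      then show "(-1) ^ (card S + 1) * real (card (acyc_orients (V - S))) =
         laplace_poly 1 (smult ((-1) ^ (card S + 1)) (stouchard (card ({v \<in> V. fst v = i} - S))) *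
           (\<Prod>j\<in>I - {i}. stouchard (card {v \<in> V. fst v = j})))"
        using S by (simp only: Q[OF i] laplace_poly_smult mult_smult_left Pow_iff Diff_iff)
    qed
    also have "\<dots> = laplace_poly 1 (\<Sum>i\<in>I. pderiv (stouchard (card {v \<in> V. fst v = i})) *
           (\<Prod>j\<in>I - {i}. stouchard (card {v \<in> V. fst v = j})))"
      using less.prems(1) by (simp add: laplace_poly_sum pderiv_stouchard_subsets sum_distrib_right)
    also have "(\<Sum>i\<in>I. pderiv (stouchard (card {v \<in> V. fst v = i})) *
           (\<Prod>j\<in>I - {i}. stouchard (card {v \<in> V. fst v = j}))) = pderiv (Q V)"
      unfolding Q_def pderiv_prod by (simp add: mult.commute)
    \<comment> \<open>The boundary term at 0 vanishes because some part is nonempty and its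
      polynomial is divisible by x.\<close>
    also have "laplace_poly 1 (pderiv (Q V)) = laplace_poly 1 (Q V)"
    proof -
      obtain v where v: "v \<in> V" using False by blast
      have "v \<in> {w \<in> V. fst w = fst v}" using v by simp
      moreover have "finite {w \<in> V. fst w = fst v}" using less.prems(1) by simp
      ultimately have "card {w \<in> V. fst w = fst v} \<noteq> 0" unfolding card_eq_0_iff by blast
      then obtain m where "card {w \<in> V. fst w = fst v} = Suc m" using not0_implies_Suc by blast
      then have "poly (stouchard (card {w \<in> V. fst w = fst v})) 0 = 0" by simp
      moreover have "fst v \<in> I" using v less.prems(2) by blast
      ultimately have "poly (Q V) 0 = 0"
        unfolding Q_def poly_prod using assms(1) by (intro prod_zero) blast+
      then show ?thesis by (simp add: laplace_poly_pderiv)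
    qed
    finally show ?thesis by (simp add: Q_def)
  qed
qed

lemma D_eq_laplace_poly: "real (D m n) = laplace_poly 1 (stouchard m ^ n)"
proof -
  let ?V = "{..<n} \<times> {..<m}"
  have "{v \<in> ?V. fst v = i} = {i} \<times> {..<m}" if "i < n" for i using that by auto
  then have "(\<Prod>i<n. stouchard (card {v \<in> ?V. fst v = i})) = stouchard m ^ n"
    by (simp add: card_cartesian_product)
  then show ?thesis
    unfolding D_eq_card_acyc_orients
    using card_acyc_orients_eq_laplace_poly[of "{..<n}" ?V] by auto
qed

section \<open>Location of the roots\<close>

declare stouchard.simps [simp del]

lemma stouchard_0 [simp]: "stouchard 0 = 1" by (simp add: stouchard.simps)

section \<open>Real-rootedness by interlacing, and a bound for the largest root\<close>

lemma poly_eq_prod_roots: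
  fixes p :: "'a :: field poly"
  assumes "finite A" "card A = degree p" "\<And>a. a \<in> A \<Longrightarrow> poly p a = 0"
  shows "p = smult (lead_coeff p) (\<Prod>a\<in>A. [:-a, 1:])"
  using assms
proof (induction A arbitrary: p rule: finite_induct)
  case empty
  then obtain c where "p = [:c:]" by (metis card.empty degree_eq_zeroE)
  then show ?case by simp
next
  case (insert a A)
  then obtain q where q: "p = [:-a, 1:] * q"
    by (metis dvdE insertI1 poly_eq_0_iff_dvd)
  have "degree p \<noteq> 0" using insert by auto
  then have "q \<noteq> 0" using q by auto
  then have dq: "degree p = Suc (degree q)" unfolding q by (subst degree_mult_eq) auto
  have "q = smult (lead_coeff q) (\<Prod>a\<in>A. [:-a, 1:])"
  proof (rule insert.IH)
    show "card A = degree q" using insert.prems(1) insert.hyps dq by simp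
    fix b assume "b \<in> A"
    then have "poly p b = 0" "b \<noteq> a" using insert by auto
    then show "poly q b = 0" by (simp add: q)
  qed
  moreover have "lead_coeff p = lead_coeff q" unfolding q lead_coeff_mult by simp
  ultimately show ?case
    using insert.hyps by (metis mult_smult_right prod.insert q)
qed

lemma degree_lead_coeff_stouchard: "degree (stouchard m) = m \<and> lead_coeff (stouchard m) = 1"
proof (induction m)
  case (Suc m)
  let ?q = "stouchard m - pderiv (stouchard m)"
  have c: "coeff ?q m = 1"
    using Suc by (simp add: coeff_pderiv coeff_eq_0) metis
  have "degree ?q \<le> m"
    using Suc degree_diff_le[of "stouchard m" m "pderiv (stouchard m)"] by (simp add: degree_pderiv)
  then have "degree ?q = m" using c by (metis le_antisym le_degree zero_neq_one)
  moreover have "?q \<noteq> 0" using c by auto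
  ultimately show ?case using c by (simp add: stouchard.simps)
qed simp

lemma degree_stouchard [simp]: "degree (stouchard m) = m"
  and lead_coeff_stouchard: "coeff (stouchard m) m = 1"
  using degree_lead_coeff_stouchard[of m] by auto

lemma stouchard_eq_prod:
  assumes "finite A" "card A = m" "\<And>a. a \<in> A \<Longrightarrow> poly (stouchard m) a = 0"
  shows "stouchard m = (\<Prod>a\<in>A. [:-a, 1:])"
  using poly_eq_prod_roots[of A "stouchard m"] assms by (simp add: lead_coeff_stouchard)

text \<open>Rolle's theorem for exp (- x) p(x), whose derivative is exp (- x) (p' - p)(x).\<close>

lemma poly_minus_pderiv_root_between:
  assumes "a < b" "poly p a = 0" "poly p b = (0 :: real)"
  obtains x where "a < x" "x < b" "poly (p - pderiv p) x = 0"
proof -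
  have "\<exists>x. a < x \<and> x < b \<and> exp (-x) * poly (pderiv p - p) x = 0"
  proof (rule Rolle_deriv[where f = "\<lambda>x. exp (-x) * poly p x" and
        f' = "\<lambda>x h. h * (exp (-x) * poly (pderiv p - p) x)", THEN exE])
    show "continuous_on {a..b} (\<lambda>x. exp (-x) * poly p x)" by (intro continuous_intros)
    show "((\<lambda>x. exp (-x) * poly p x) has_derivative (\<lambda>h. h * (exp (-x) * poly (pderiv p - p) x))) (at x)" for x
    proof -
      have "DERIV (\<lambda>x. exp (-x) * poly p x) x :> exp (-x) * poly (pderiv p - p) x"
        by (auto intro!: derivative_eq_intros simp: algebra_simps)
      then show ?thesis by (rule has_field_derivative_imp_has_derivative[THEN has_derivative_eq_rhs]) auto
    qed
  qed (use assms in \<open>auto simp: fun_eq_iff dest: spec[of _ 1]\<close>)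
  then show ?thesis using that by auto
qed

definition ascending_roots :: "real poly \<Rightarrow> nat \<Rightarrow> (nat \<Rightarrow> real) \<Rightarrow> bool" where
  "ascending_roots p m \<rho> \<longleftrightarrow>
     (\<forall>i<m. 0 \<le> \<rho> i \<and> poly p (\<rho> i) = 0) \<and> (\<forall>i. Suc i < m \<longrightarrow> \<rho> i < \<rho> (Suc i))"

lemma ascending_roots_less:
  assumes "ascending_roots p m \<rho>" "i < j" "j < m"
  shows "\<rho> i < \<rho> j"
  using assms(2,3)
proof (induction j)
  case (Suc j)
  then have "\<rho> j < \<rho> (Suc j)" using assms(1) by (auto simp: ascending_roots_def)
  moreover have "i = j \<or> \<rho> i < \<rho> j" using Suc by (auto simp: less_Suc_eq)
  ultimately show ?case by auto
qed simp

lemma ascending_roots_inj: "ascending_roots p m \<rho> \<Longrightarrow> inj_on \<rho> {..<m}"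
  by (rule inj_onI) (metis ascending_roots_less lessThan_iff linorder_neq_iff)

text \<open>At its largest root the polynomial has positive derivative, so p - p' is negative there;
  being monic, p - p' is eventually positive.\<close>

lemma stouchard_root_greater:
  assumes "ascending_roots (stouchard (Suc m)) (Suc m) \<rho>"
  obtains x where "\<rho> m < x" "poly (stouchard (Suc m) - pderiv (stouchard (Suc m))) x = 0"
proof -
  let ?p = "stouchard (Suc m)" and ?A = "\<rho> ` {..<Suc m}"
  let ?q = "?p - pderiv ?p"
  have p: "?p = (\<Prod>a\<in>?A. [:-a, 1:])"
    using assms ascending_roots_inj[OF assms]
    by (intro stouchard_eq_prod) (auto simp: card_image ascending_roots_def)
  have "pderiv ?p = (\<Sum>a\<in>?A. \<Prod>b\<in>?A - {a}. [:-b, 1:])"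
    unfolding p by (subst pderiv_prod) (simp add: pderiv_pCons)
  then have "poly (pderiv ?p) (\<rho> m) = (\<Sum>a\<in>?A. \<Prod>b\<in>?A - {a}. \<rho> m - b)"
    by (simp add: poly_sum poly_prod)
  \<comment> \<open>Every other summand still contains the factor that vanishes at
    \<open>\<rho> m\<close>.\<close>
  also have "\<dots> = (\<Prod>b\<in>?A - {\<rho> m}. \<rho> m - b)"
  proof (subst sum.remove[of _ "\<rho> m"])
    show "(\<Prod>b\<in>?A - {\<rho> m}. \<rho> m - b) + (\<Sum>a\<in>?A - {\<rho> m}. \<Prod>b\<in>?A - {a}. \<rho> m - b) =
        (\<Prod>b\<in>?A - {\<rho> m}. \<rho> m - b)"
      by (simp, intro sum.neutral ballI prod_zero) auto
  qed auto
  also have "\<dots> > 0"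
  proof (rule prod_pos)
    fix b assume b: "b \<in> ?A - {\<rho> m}"
    then obtain i where i: "i < Suc m" "b = \<rho> i" by blast
    then have "i < m" using b by (auto simp: less_Suc_eq)
    then show "0 < \<rho> m - b" using ascending_roots_less[OF assms, of i m] i by simp
  qed
  finally have neg: "poly ?q (\<rho> m) < 0"
    using assms by (simp add: ascending_roots_def)
  have c: "coeff ?q (Suc m) = 1"
    by (simp add: coeff_pderiv coeff_eq_0 lead_coeff_stouchard)
  have "degree ?q \<le> Suc m"
    by (rule degree_diff_le) (simp_all add: degree_pderiv)
  then have "degree ?q = Suc m" using c by (metis le_antisym le_degree zero_neq_one)
  then have "lead_coeff ?q > 0" using c by simp
  then obtain M where M: "\<And>x. x \<ge> M \<Longrightarrow> poly ?q x \<ge> lead_coeff ?q"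
    using poly_pinfty_gt_lc by blast
  define b where "b = max M (\<rho> m + 1)"
  have "poly ?q b > 0" using M[of b] \<open>lead_coeff ?q > 0\<close> unfolding b_def by linarith
  moreover have "\<rho> m < b" by (simp add: b_def)
  ultimately obtain x where "\<rho> m < x" "poly ?q x = 0"
    using poly_IVT_pos[of "\<rho> m" b ?q] neg by blast
  then show ?thesis by (rule that)
qed

text \<open>The recursion multiplies p - p' by x. Rolle gives a root of p - p' between consecutive
  roots of p, one more lies beyond the largest, and the factor x adds the root 0.\<close>

lemma stouchard_ascending_roots: "\<exists>\<rho>. ascending_roots (stouchard m) m \<rho>"
proof (induction m)
  case 0
  then show ?case by (simp add: ascending_roots_def)
next
  case (Suc m)
  then obtain \<rho> where \<rho>: "ascending_roots (stouchard m) m \<rho>" by blast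
  let ?q = "stouchard m - pderiv (stouchard m)"
  have "\<exists>x. \<rho> i < x \<and> (Suc i < m \<longrightarrow> x < \<rho> (Suc i)) \<and> poly ?q x = 0" if "i < m" for i
  proof (cases "Suc i < m")
    case True
    then show ?thesis
      using poly_minus_pderiv_root_between[of "\<rho> i" "\<rho> (Suc i)" "stouchard m"] \<rho>
      unfolding ascending_roots_def by (metis Suc_lessD)
  next
    case False
    then have "m = Suc i" using that by simp
    then show ?thesis using stouchard_root_greater[of i \<rho>] \<rho> by blast
  qed
  then obtain \<sigma> where \<sigma>: "\<And>i. i < m \<Longrightarrow> \<rho> i < \<sigma> i \<and> (Suc i < m \<longrightarrow> \<sigma> i < \<rho> (Suc i)) \<and> poly ?q (\<sigma> i) = 0"
    by metis
  have "ascending_roots (stouchard (Suc m)) (Suc m) (\<lambda>i. case i of 0 \<Rightarrow> 0 | Suc j \<Rightarrow> \<sigma> j)"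
    unfolding ascending_roots_def
  proof (intro conjI allI impI)
    fix i assume i: "i < Suc m"
    have pos: "0 \<le> \<sigma> j" if "j < m" for j
      using \<sigma>[OF that] \<rho> that unfolding ascending_roots_def by force
    show "0 \<le> (case i of 0 \<Rightarrow> 0 | Suc j \<Rightarrow> \<sigma> j)"
      using pos i by (auto split: nat.split)
    show "poly (stouchard (Suc m)) (case i of 0 \<Rightarrow> 0 | Suc j \<Rightarrow> \<sigma> j) = 0"
      using \<sigma> i by (auto simp: stouchard.simps split: nat.split)
  next
    fix i assume i: "Suc i < Suc m"
    show "(case i of 0 \<Rightarrow> 0 | Suc j \<Rightarrow> \<sigma> j) < (case Suc i of 0 \<Rightarrow> 0 | Suc j \<Rightarrow> \<sigma> j)"
    proof (cases i)
      case 0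
      then show ?thesis using \<sigma>[of 0] \<rho> i by (force simp: ascending_roots_def)
    next
      case (Suc j)
      then show ?thesis using \<sigma>[of j] \<sigma>[of "Suc j"] i by auto
    qed
  qed
  then show ?case by blast
qed

text \<open>In x (P - 1)^m the leading term dominates. If each step so far multiplied by at least x
  / 2, the remaining terms sum to at most ((1 + 2/x)^m - 1) times it. For 6 m <= x the power is at
  most e^(1/3) < 3/2, so at least half of the leading term survives, which is growth by x / 2
  again.\<close>

lemma stouchard_growth:
  assumes "0 < x" "6 * real m \<le> x"
  shows "poly (stouchard m) x > 0 \<and> (\<forall>j<m. poly (stouchard j) x > 0 \<and> poly (stouchard (Suc j)) x \<ge> x / 2 * poly (stouchard j) x)"
  using assms(2)
proof (induction m)
  case (Suc m)
  let ?P = "\<lambda>m. poly (stouchard m) x"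
  have pos: "?P m > 0" and grow: "\<And>j. j < m \<Longrightarrow> ?P (Suc j) \<ge> x / 2 * ?P j" using Suc by auto
  have posj: "0 < ?P j" if "j \<le> m" for j
    using Suc that by (cases "j = m") auto
  then have nonneg: "0 \<le> ?P j" if "j \<le> m" for j using that by (simp add: less_imp_le)
  have geom: "?P (m - k) \<le> (2 / x) ^ k * ?P m \<and> 0 \<le> ?P (m - k)" if "k \<le> m" for k
    using that
  proof (induction k)
    case (Suc k)
    then have "Suc (m - Suc k) = m - k" by simp
    then have "x / 2 * ?P (m - Suc k) \<le> ?P (m - k)" using grow[of "m - Suc k"] Suc.prems by simp
    then have "?P (m - Suc k) \<le> 2 / x * ?P (m - k)" using assms(1) by (simp add: field_simps)
    also have "\<dots> \<le> 2 / x * ((2 / x) ^ k * ?P m)"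
      using Suc assms(1) by (intro mult_left_mono) auto
    finally show ?case using nonneg[of "m - Suc k"] by simp
  qed (use pos in auto)
  have "(1 + 2 / x) ^ m \<le> exp (2 / x) ^ m"
    using assms by (intro power_mono exp_ge_add_one_self) auto
  also have "\<dots> = exp (real m * (2 / x))" by (rule exp_of_nat_mult[symmetric])
  also have "\<dots> \<le> exp (1 / 3)"
    using Suc.prems assms by (simp add: field_simps)
  also have "\<dots> \<le> 1 + 1 / 3 + (1 / 3)\<^sup>2" by (rule exp_bound) auto
  finally have small: "(1 + 2 / x) ^ m \<le> 3 / 2" by (simp add: power2_eq_square)
  have "\<bar>(\<Sum>k\<in>{1..m}. (-1) ^ k * real (m choose k) * ?P (m - k))\<bar> \<le>
      (\<Sum>k\<in>{1..m}. real (m choose k) * (2 / x) ^ k * ?P m)"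
  proof (rule order_trans[OF sum_abs], rule sum_mono)
    fix k assume "k \<in> {1..m}"
    then show "\<bar>(-1) ^ k * real (m choose k) * ?P (m - k)\<bar> \<le> real (m choose k) * (2 / x) ^ k * ?P m"
      using geom[of k] by (simp add: abs_mult mult.assoc mult_left_mono)
  qed
  also have "\<dots> = ((1 + 2 / x) ^ m - 1) * ?P m"
  proof -
    have "(1 + 2 / x) ^ m = (\<Sum>k\<le>m. real (m choose k) * (2 / x) ^ k)"
      by (subst add.commute) (simp add: binomial_ring)
    also have "\<dots> = 1 + (\<Sum>k\<in>{1..m}. real (m choose k) * (2 / x) ^ k)"
      by (simp add: atMost_atLeast0 sum.atLeast_Suc_atMost)
    finally show ?thesis by (simp add: sum_distrib_right)
  qed
  also have "\<dots> \<le> 1 / 2 * ?P m" using small pos by (intro mult_right_mono) auto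
  finally have "?P m / 2 \<le> ?P m + (\<Sum>k\<in>{1..m}. (-1) ^ k * real (m choose k) * ?P (m - k))" by linarith
  also have "\<dots> = poly (stouchard_diff m) x"
    by (simp add: stouchard_diff_def poly_sum atMost_atLeast0 sum.atLeast_Suc_atMost)
  finally have "x * (?P m / 2) \<le> ?P (Suc m)"
    using assms(1) unfolding stouchard_Suc by simp
  then have "x / 2 * ?P m \<le> ?P (Suc m)" by simp
  moreover have "0 < x / 2 * ?P m" using assms pos by simp
  ultimately show ?case using grow posj by (auto simp: less_Suc_eq)
qed simp

lemma stouchard_eq_prod_bounded_roots:
  obtains A where "finite A" "card A = m" "A \<subseteq> {0..6 * real m}" "stouchard m = (\<Prod>a\<in>A. [:-a, 1:])"
proof -
  obtain \<rho> where \<rho>: "ascending_roots (stouchard m) m \<rho>" using stouchard_ascending_roots by blast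
  have card: "card (\<rho> ` {..<m}) = m" using ascending_roots_inj[OF \<rho>] by (simp add: card_image)
  show ?thesis
  proof (rule that[of "\<rho> ` {..<m}"])
    show "stouchard m = (\<Prod>a\<in>\<rho> ` {..<m}. [:- a, 1:])"
      using card \<rho> by (intro stouchard_eq_prod) (auto simp: ascending_roots_def)
    show "\<rho> ` {..<m} \<subseteq> {0..6 * real m}"
    proof
      fix a assume "a \<in> \<rho> ` {..<m}"
      then have a: "0 \<le> a" "poly (stouchard m) a = 0" "m > 0"
        using \<rho> by (auto simp: ascending_roots_def)
      then show "a \<in> {0..6 * real m}"
        using stouchard_growth[of a m] by (cases "a \<le> 6 * real m") auto
    qed
  qed (use card in auto)
qed

text \<open>
  In the variable \<open>u = 1 / v\<close> the function \<open>\<Sum>a\<in>A. ln (1 + (d - a) * u)\<close> is concave; \<open>d\<close> is chosen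
  such that it has its maximum at \<open>u = 1 / N\<close>.
\<close>

lemma prod_roots_approx:
  fixes A :: "real set" and m :: nat and N :: real
  assumes A: "finite A" "card A = m" "A \<subseteq> {0..6 * real m}" and m: "m > 0" and N: "12 * real m \<le> N"
  obtains d \<kappa> where "0 \<le> d" "d \<le> 6 * real m" "(1 / 2) ^ m \<le> \<kappa>"
    "\<And>v. 12 * real m \<le> v \<Longrightarrow> (\<Prod>a\<in>A. v + d - a) \<le> \<kappa> * v ^ m"
    "\<And>v. 12 * real m \<le> v \<Longrightarrow>
       \<kappa> * v ^ m * exp (- (144 * real m ^ 3 * (1 / v - 1 / N)\<^sup>2)) \<le> (\<Prod>a\<in>A. v + d - a)"
proof -
  define M where "M = 6 * real m"
  have M: "M > 0" "2 * M \<le> N" and AM: "\<And>a. a \<in> A \<Longrightarrow> 0 \<le> a \<and> a \<le> M"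
    using m N A(3) by (auto simp: M_def)
  \<comment> \<open>All summands are nonpositive at d = 0 and nonnegative at d = M, since the roots
    lie in [0, M].\<close>
  have "\<exists>d\<ge>0. d \<le> M \<and> (\<Sum>a\<in>A. (d - a) / (N + (d - a))) = 0"
  proof (rule IVT')
    show "(\<Sum>a\<in>A. (0 - a) / (N + (0 - a))) \<le> 0"
      using AM M by (intro sum_nonpos divide_nonpos_nonneg) force+
    show "0 \<le> (\<Sum>a\<in>A. (M - a) / (N + (M - a)))"
      using AM M by (intro sum_nonneg divide_nonneg_nonneg) force+
    show "continuous_on {0..M} (\<lambda>d. \<Sum>a\<in>A. (d - a) / (N + (d - a)))"
      using AM M by (intro continuous_intros) force
  qed (use M in auto)
  then obtain d where d: "0 \<le> d" "d \<le> M" "(\<Sum>a\<in>A. (d - a) / (N + (d - a))) = 0" by blast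
  define f where "f = (\<lambda>u a. 1 + (d - a) * u)"
  define \<kappa> where "\<kappa> = (\<Prod>a\<in>A. f (1 / N) a)"
  \<comment> \<open>The threshold 12 m = 2 M comes from here: d - a >= - M keeps every factor at
    least 1/2.\<close>
  have f: "1 / 2 \<le> f (1 / v) a" if "2 * M \<le> v" "a \<in> A" for v a
  proof -
    have "- (v / 2) \<le> d - a" using that d AM[of a] by auto
    then have "- (v / 2) / v \<le> (d - a) / v" using that M by (intro divide_right_mono) auto
    moreover have "- (v / 2) / v = - (1 / 2)" using that M by simp
    ultimately have "- (1 / 2) \<le> (d - a) * (1 / v)" by simp
    then show ?thesis unfolding f_def by linarith
  qed
  have \<kappa>0: "\<kappa> > 0" unfolding \<kappa>_def using f[OF M(2)] by (intro prod_pos) force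
  have split: "(\<Prod>a\<in>A. v + d - a) = v ^ m * (\<Prod>a\<in>A. f (1 / v) a)" if "2 * M \<le> v" for v
  proof -
    have "(\<Prod>a\<in>A. v + d - a) = (\<Prod>a\<in>A. v * f (1 / v) a)"
      using that M by (intro prod.cong refl) (simp add: f_def field_simps)
    then show ?thesis using A by (simp add: prod.distrib)
  qed
  \<comment> \<open>The derivative of the sum of ln f at u = 1 / N, so linear terms drop out of the
    bounds below.\<close>
  have c0: "(\<Sum>a\<in>A. (d - a) / f (1 / N) a) = 0"
  proof -
    have "(\<Sum>a\<in>A. (d - a) / f (1 / N) a) = (\<Sum>a\<in>A. N * ((d - a) / (N + (d - a))))"
    proof (intro sum.cong refl)
      fix a
      have "f (1 / N) a = (N + (d - a)) / N" using M by (simp add: f_def field_simps)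
      then show "(d - a) / f (1 / N) a = N * ((d - a) / (N + (d - a)))" by simp
    qed
    then show ?thesis using d(3) unfolding sum_distrib_left[symmetric] by simp
  qed
  have c1: "(\<Sum>a\<in>A. w * ((d - a) / f (1 / N) a)) = 0" for w
    unfolding sum_distrib_left[symmetric] c0 by simp
  have ratio: "(\<Prod>a\<in>A. f (1 / v) a) = \<kappa> * exp (\<Sum>a\<in>A. ln (f (1 / v) a / f (1 / N) a))" if "2 * M \<le> v" for v
  proof -
    have "exp (\<Sum>a\<in>A. ln (f (1 / v) a / f (1 / N) a)) = (\<Prod>a\<in>A. f (1 / v) a / f (1 / N) a)"
      unfolding exp_sum[OF A(1)]
    proof (intro prod.cong refl exp_ln)
      fix a assume "a \<in> A"
      then show "f (1 / v) a / f (1 / N) a > 0" using f[of v a] f[of N a] that M by simp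
    qed
    then show ?thesis using \<kappa>0 by (simp add: prod_dividef \<kappa>_def)
  qed
  have quot: "f (1 / v) a / f (1 / N) a = 1 + (1 / v - 1 / N) * ((d - a) / f (1 / N) a)" if "a \<in> A" for v a
  proof -
    have "1 + c * x = 1 + c * y + (x - y) * c" for c x y :: real by (simp add: algebra_simps)
    then have "f (1 / v) a = f (1 / N) a + (1 / v - 1 / N) * (d - a)" unfolding f_def .
    then show ?thesis using f[OF M(2) that] by (simp add: add_divide_distrib)
  qed
  have upper: "(\<Sum>a\<in>A. ln (f (1 / v) a / f (1 / N) a)) \<le> 0" if "2 * M \<le> v" for v
  proof -
    have "(\<Sum>a\<in>A. ln (f (1 / v) a / f (1 / N) a)) \<le> (\<Sum>a\<in>A. (1 / v - 1 / N) * ((d - a) / f (1 / N) a))"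
    proof (rule sum_mono)
      fix a assume a: "a \<in> A"
      then have "f (1 / v) a / f (1 / N) a > 0" using f[of v a] f[of N a] that M by simp
      then show "ln (f (1 / v) a / f (1 / N) a) \<le> (1 / v - 1 / N) * ((d - a) / f (1 / N) a)"
        using ln_le_minus_one quot[OF a, of v] by fastforce
    qed
    then show ?thesis unfolding c1 .
  qed
  \<comment> \<open>With p, q the values of f at 1/v and 1/N, ln (p/q) >= (p - q)/p, which falls
    short of the linear term (p - q)/q by (p - q)^2/(p q) <= 4 (p - q)^2. As |d - a| <= 6 m, each of
    the m roots costs at most 144 m^2 (1/v - 1/N)^2.\<close>
  have lower: "- (144 * real m ^ 3 * (1 / v - 1 / N)\<^sup>2) \<le> (\<Sum>a\<in>A. ln (f (1 / v) a / f (1 / N) a))"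
    if v: "2 * M \<le> v" for v
  proof -
    let ?w = "1 / v - 1 / N"
    have "(\<Sum>a\<in>A. ?w * ((d - a) / f (1 / N) a) - 4 * M\<^sup>2 * ?w\<^sup>2) \<le> (\<Sum>a\<in>A. ln (f (1 / v) a / f (1 / N) a))"
    proof (rule sum_mono)
      fix a assume a: "a \<in> A"
      define p q where "p = f (1 / v) a" and "q = f (1 / N) a"
      have pq: "p \<ge> 1 / 2" "q \<ge> 1 / 2" using f a v M by (auto simp: p_def q_def)
      have "1 + c * x - (1 + c * y) = (x - y) * c" for c x y :: real by (simp add: algebra_simps)
      then have diff: "p - q = ?w * (d - a)" unfolding p_def q_def f_def .
      have "?w * (d - a) / q - (p - q) / p = (?w * (d - a))\<^sup>2 / (p * q)"
        using pq unfolding diff[symmetric] by (simp add: field_simps power2_eq_square)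
      also have "\<dots> \<le> (?w * (d - a))\<^sup>2 / (1 / 4)"
        using mult_mono[of "1 / 2" p "1 / 2" q] pq by (intro divide_left_mono) auto
      also have "\<dots> = 4 * (d - a)\<^sup>2 * ?w\<^sup>2" by (simp add: power_mult_distrib)
      also have "(d - a)\<^sup>2 \<le> M\<^sup>2"
        using d AM[OF a] by (intro abs_le_square_iff[THEN iffD1]) auto
      finally have "?w * (d - a) / q - 4 * M\<^sup>2 * ?w\<^sup>2 \<le> (p - q) / p"
        by (simp add: mult_right_mono algebra_simps)
      also have "\<dots> = - (q / p - 1)" using pq by (simp add: field_simps)
      also have "\<dots> \<le> - ln (q / p)" using pq ln_le_minus_one[of "q / p"] by simp
      also have "\<dots> = ln (p / q)" using pq by (simp add: ln_div)
      finally show "?w * ((d - a) / f (1 / N) a) - 4 * M\<^sup>2 * ?w\<^sup>2 \<le> ln (f (1 / v) a / f (1 / N) a)"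
        by (simp add: p_def q_def)
    qed
    also have "(\<Sum>a\<in>A. ?w * ((d - a) / f (1 / N) a) - 4 * M\<^sup>2 * ?w\<^sup>2) = - (real m * (4 * M\<^sup>2 * ?w\<^sup>2))"
      unfolding sum_subtractf c1 using A by simp
    also have "real m * (4 * M\<^sup>2 * ?w\<^sup>2) = 144 * real m ^ 3 * ?w\<^sup>2"
      by (simp add: M_def power2_eq_square power3_eq_cube)
    finally show ?thesis .
  qed
  show ?thesis
  proof (rule that[of d \<kappa>])
    show "d \<le> 6 * real m" using d M_def by simp
    have "(\<Prod>a\<in>A. 1 / 2 :: real) \<le> \<kappa>" unfolding \<kappa>_def using f[OF M(2)] by (intro prod_mono) auto
    then show "(1 / 2) ^ m \<le> \<kappa>" using A by simp
  next
    fix v assume "12 * real m \<le> v"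
    then have v: "2 * M \<le> v" "v > 0" using M by (auto simp: M_def)
    have eq: "(\<Prod>a\<in>A. v + d - a) = \<kappa> * v ^ m * exp (\<Sum>a\<in>A. ln (f (1 / v) a / f (1 / N) a))"
      unfolding split[OF v(1)] ratio[OF v(1)] by simp
    show "(\<Prod>a\<in>A. v + d - a) \<le> \<kappa> * v ^ m"
      unfolding eq using upper[OF v(1)] \<kappa>0 v by (intro mult_left_le) auto
    show "\<kappa> * v ^ m * exp (- (144 * real m ^ 3 * (1 / v - 1 / N)\<^sup>2)) \<le> (\<Prod>a\<in>A. v + d - a)"
      unfolding eq using lower[OF v(1)] \<kappa>0 v by (intro mult_left_mono) auto
  qed (use d in auto)
qed

section \<open>Laplace transforms of powers\<close>

text \<open>The Erlang density of shape 0 is the exponential density y e^(-y x); its moments are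
  divided by y.\<close>

lemma has_bochner_integral_exp_power:
  fixes y :: real
  assumes "y > 0"
  shows "has_bochner_integral lborel (\<lambda>x. indicator {0..} x * (exp (- (y * x)) * x ^ k)) (fact k / y ^ Suc k)"
proof -
  have "has_bochner_integral lborel (\<lambda>x. erlang_density 0 y x * x ^ k) (fact k / y ^ k)"
  proof (rule has_bochner_integral_nn_integral)
    show "AE x in lborel. 0 \<le> erlang_density 0 y x * x ^ k"
      using assms by (intro AE_I2) (auto simp: erlang_density_def)
    show "(\<integral>\<^sup>+ x. ennreal (erlang_density 0 y x * x ^ k) \<partial>lborel) = ennreal (fact k / y ^ k)"
      using nn_integral_erlang_ith_moment[OF assms, of 0 k] by simp
  qed (use assms in auto)
  then have "has_bochner_integral lborel (\<lambda>x. (1 / y) * (erlang_density 0 y x * x ^ k)) ((1 / y) * (fact k / y ^ k))"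
    by (intro has_bochner_integral_mult_right) auto
  moreover have "(\<lambda>x. (1 / y) * (erlang_density 0 y x * x ^ k)) = (\<lambda>x. indicator {0..} x * (exp (- (y * x)) * x ^ k))"
    using assms by (auto simp: erlang_density_def fun_eq_iff)
  moreover have "(1 / y) * (fact k / y ^ k) = fact k / y ^ Suc k" by simp
  ultimately show ?thesis by metis
qed

lemma has_bochner_integral_laplace_poly:
  assumes "y > 0"
  shows "has_bochner_integral lborel (\<lambda>x. indicator {0..} x * (exp (- (y * x)) * poly p x)) (laplace_poly y p)"
proof -
  have "has_bochner_integral lborel
      (\<lambda>x. \<Sum>k\<le>degree p. coeff p k * (indicator {0..} x * (exp (- (y * x)) * x ^ k)))
      (\<Sum>k\<le>degree p. coeff p k * (fact k / y ^ Suc k))"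
    using has_bochner_integral_exp_power[OF assms]
    by (intro has_bochner_integral_sum has_bochner_integral_mult_right) auto
  moreover have "(\<lambda>x. \<Sum>k\<le>degree p. coeff p k * (indicator {0..} x * (exp (- (y * x)) * x ^ k))) =
      (\<lambda>x. indicator {0..} x * (exp (- (y * x)) * poly p x))"
    by (auto simp: poly_altdef sum_distrib_left mult_ac fun_eq_iff intro!: sum.cong)
  ultimately show ?thesis by (simp add: laplace_poly_def)
qed

text \<open>A single term of the series for e^M, with e <= 3.\<close>

lemma power_le_exp_fact: "real M ^ M \<le> 3 ^ M * fact M"
proof -
  have "(\<Sum>k\<in>{M}. inverse (fact k) * real M ^ k) \<le> (\<Sum>k. inverse (fact k) * real M ^ k)"
    using summable_exp[of "real M"] by (intro sum_le_suminf) auto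
  then have "real M ^ M / fact M \<le> exp (real M)"
    by (simp add: exp_def scaleR_conv_of_real divide_inverse mult.commute)
  also have "\<dots> = exp 1 ^ M" by (simp add: exp_of_nat_mult[symmetric])
  also have "\<dots> \<le> 3 ^ M" using exp_le by (intro power_mono) auto
  finally show ?thesis by (simp add: field_simps)
qed

text \<open>After the shift s = v + d the integrand is compared pointwise with the Gamma integrand.
  The first summand is a crude bound on -d <= v <= 12 m, an interval of length at most 18 m on which
  each factor is at most 18 m in absolute value. Beyond it, 1 - exp (- k \<delta>) <= k \<delta>,
  and the second summand is the exact integral of this error against the Gamma weight.\<close>

lemma laplace_poly_error_bound:
  fixes A :: "real set" and m n k :: nat and d \<kappa> :: real
  defines "M \<equiv> m * k" and "y \<equiv> real k / real n" and "N \<equiv> real (m * n)"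
  assumes A: "finite A" "card A = m" "A \<subseteq> {0..6 * real m}" "p = (\<Prod>a\<in>A. [:-a, 1:])"
    and m: "m \<ge> 2" and n: "n > 0" and k: "k > 0"
    and d: "0 \<le> d" "d \<le> 6 * real m" and \<kappa>: "0 < \<kappa>"
    and up: "\<And>v. 12 * real m \<le> v \<Longrightarrow> (\<Prod>a\<in>A. v + d - a) \<le> \<kappa> * v ^ m"
    and lo: "\<And>v. 12 * real m \<le> v \<Longrightarrow>
       \<kappa> * v ^ m * exp (- (144 * real m ^ 3 * (1 / v - 1 / N)\<^sup>2)) \<le> (\<Prod>a\<in>A. v + d - a)"
  shows "\<bar>laplace_poly y (p ^ k) - exp (- (y * d)) * \<kappa> ^ k * (fact M / y ^ Suc M)\<bar> \<le>
    ((18 * real m) ^ M + exp (- (y * d)) * \<kappa> ^ k * (12 * real m) ^ M) * (18 * real m) +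
    exp (- (y * d)) * \<kappa> ^ k * (real k * (144 * real m ^ 3)) *
      (fact (M - 2) / y ^ (M - 1) - 2 / N * (fact (M - 1) / y ^ M) + 1 / N\<^sup>2 * (fact M / y ^ Suc M))"
proof -
  have y: "y > 0" and N: "N > 0" using m n k by (auto simp: y_def N_def)
  have M: "M \<ge> 2" using m k by (metis M_def One_nat_def Suc_leI mult.right_neutral mult_le_mono)
  define w where "w = exp (- (y * d)) * \<kappa> ^ k"
  have w: "w > 0" using \<kappa> by (simp add: w_def)
  \<comment> \<open>The support of \<open>F\<close> starts at -d, that of the Gamma weight at 0; the
    mismatch is absorbed by \<open>B\<close>.\<close>
  define F where "F = (\<lambda>v. indicator {-d..} v * (exp (- (y * (v + d))) * (\<Prod>a\<in>A. v + d - a) ^ k))"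
  define e where "e = (\<lambda>v r. indicator {0..} v * (exp (- (y * v)) * v ^ r) :: real)"
  define G where "G = (\<lambda>v. w * e v M)"
  \<comment> \<open>The expansion of v^M (1/v - 1/N)^2 into three Gamma weights; M >= 2 keeps the
    exponents natural.\<close>
  define E where "E = (\<lambda>v. w * (real k * (144 * real m ^ 3)) *
      (e v (M - 2) - 2 / N * e v (M - 1) + 1 / N\<^sup>2 * e v M))"
  define B0 where "B0 = (18 * real m) ^ M + w * (12 * real m) ^ M"
  define B where "B = (\<lambda>v. B0 * indicator {-d..12 * real m} v)"
  have int_e: "has_bochner_integral lborel (\<lambda>v. e v r) (fact r / y ^ Suc r)" for r
    unfolding e_def by (rule has_bochner_integral_exp_power[OF y])
  have int_F: "has_bochner_integral lborel F (laplace_poly y (p ^ k))"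
  proof -
    have "has_bochner_integral lborel (\<lambda>x. indicator {0..} (d + 1 * x) * (exp (- (y * (d + 1 * x))) * poly (p ^ k) (d + 1 * x)))
        (laplace_poly y (p ^ k) /\<^sub>R \<bar>1\<bar>)"
      using has_bochner_integral_laplace_poly[OF y, of "p ^ k"]
      by (subst lborel_has_bochner_integral_real_affine_iff[symmetric]) auto
    moreover have "(\<lambda>x. indicator {0..} (d + 1 * x) * (exp (- (y * (d + 1 * x))) * poly (p ^ k) (d + 1 * x))) = F"
      unfolding F_def A(4) by (auto simp: fun_eq_iff indicator_def poly_prod add.commute)
    ultimately show ?thesis by simp
  qed
  have int_G: "has_bochner_integral lborel G (w * (fact M / y ^ Suc M))"
    unfolding G_def by (intro has_bochner_integral_mult_right int_e)
  define IE where "IE = w * (real k * (144 * real m ^ 3)) *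
      (fact (M - 2) / y ^ (M - 1) - 2 / N * (fact (M - 1) / y ^ M) + 1 / N\<^sup>2 * (fact M / y ^ Suc M))"
  have int_E: "has_bochner_integral lborel E IE"
  proof -
    have "Suc (M - 2) = M - 1" "Suc (M - 1) = M" using M by auto
    then have "has_bochner_integral lborel (\<lambda>v. e v (M - 2)) (fact (M - 2) / y ^ (M - 1))"
        "has_bochner_integral lborel (\<lambda>v. e v (M - 1)) (fact (M - 1) / y ^ M)"
      using int_e[of "M - 2"] int_e[of "M - 1"] by auto
    then show ?thesis unfolding E_def IE_def
      by (intro has_bochner_integral_mult_right has_bochner_integral_add has_bochner_integral_diff int_e)
  qed
  have int_B: "has_bochner_integral lborel B (B0 * (12 * real m + d))"
  proof -
    have "has_bochner_integral lborel (indicator {-d..12 * real m}) (measure lborel {-d..12 * real m})"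
      by (rule has_bochner_integral_real_indicator) (auto simp: emeasure_lborel_Icc_eq)
    then show ?thesis using d unfolding B_def by (intro has_bochner_integral_mult_right) simp
  qed
  have B0: "B0 \<ge> 0" using w by (simp add: B0_def)
  have Eeq: "E v = w * (real k * (144 * real m ^ 3)) * (exp (- (y * v)) * (v ^ (M - 2) * (1 - v / N)\<^sup>2))" if "v \<ge> 0" for v
  proof -
    obtain r where r: "M = Suc (Suc r)" using M by (metis add_2_eq_Suc le_Suc_ex)
    show ?thesis using that N
      unfolding E_def e_def r by (simp add: power2_eq_square algebra_simps) 
  qed
  have E0: "E v \<ge> 0" for v
  proof (cases "v \<ge> 0")
    case True
    then show ?thesis unfolding Eeq[OF True] using w by simp
  next
    case False
    then show ?thesis by (simp add: E_def e_def)
  qed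
  have bound: "\<bar>F v - G v\<bar> \<le> B v + E v" for v
  proof -
    consider "v < -d" | "-d \<le> v" "v \<le> 12 * real m" | "v > 12 * real m" by linarith
    then show ?thesis
    proof cases
      case 1
      then show ?thesis using d E0[of v] by (simp add: F_def G_def B_def e_def indicator_def)
    next
      case 2
      have "\<bar>\<Prod>a\<in>A. v + d - a\<bar> \<le> (\<Prod>a\<in>A. 18 * real m)"
        unfolding abs_prod
      proof (rule prod_mono)
        fix a assume "a \<in> A"
        then have "0 \<le> a" "a \<le> 6 * real m" using A by auto
        then show "0 \<le> \<bar>v + d - a\<bar> \<and> \<bar>v + d - a\<bar> \<le> 18 * real m" using 2 d by auto
      qed
      then have "\<bar>\<Prod>a\<in>A. v + d - a\<bar> ^ k \<le> ((18 * real m) ^ m) ^ k" using A by (intro power_mono) auto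
      then have "exp (- (y * (v + d))) * \<bar>\<Prod>a\<in>A. v + d - a\<bar> ^ k \<le> 1 * ((18 * real m) ^ m) ^ k"
        using 2 y by (intro mult_mono) auto
      then have "\<bar>F v\<bar> \<le> (18 * real m) ^ M"
        unfolding F_def M_def power_mult using 2 by (simp only: abs_mult power_abs) simp
      moreover have "\<bar>G v\<bar> \<le> w * (12 * real m) ^ M"
      proof (cases "v \<ge> 0")
        case True
        then have "exp (- (y * v)) * v ^ M \<le> 1 * (12 * real m) ^ M"
          using 2 y by (intro mult_mono power_mono) auto
        then show ?thesis using True w by (simp add: G_def e_def abs_mult)
      qed (use w in \<open>auto simp: G_def e_def\<close>)
      moreover have "B v = B0" using 2 by (simp add: B_def)
      ultimately show ?thesis using E0[of v] unfolding B0_def by linarith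
    next
      case 3
      define Q where "Q = (\<Prod>a\<in>A. v + d - a)"
      define \<delta> where "\<delta> = 144 * real m ^ 3 * (1 / v - 1 / N)\<^sup>2"
      have v: "v > 0" "v \<ge> 12 * real m" using 3 by auto
      have Q: "Q \<le> \<kappa> * v ^ m" "\<kappa> * v ^ m * exp (- \<delta>) \<le> Q"
        unfolding Q_def \<delta>_def using up lo v by auto
      have Q0: "0 \<le> Q" using Q(2) \<kappa> v by (smt (verit) exp_gt_zero mult_pos_pos zero_less_power)
      have eq: "(\<kappa> * v ^ m) ^ k = \<kappa> ^ k * v ^ M" by (simp add: power_mult_distrib M_def power_mult)
      have "Q ^ k \<le> (\<kappa> * v ^ m) ^ k" by (intro power_mono Q Q0)
      then have Q1: "Q ^ k \<le> \<kappa> ^ k * v ^ M" unfolding eq .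
      have "(\<kappa> * v ^ m * exp (- \<delta>)) ^ k \<le> Q ^ k" using \<kappa> v by (intro power_mono Q) auto
      also have "(\<kappa> * v ^ m * exp (- \<delta>)) ^ k = (\<kappa> ^ k * v ^ M) * exp (- (real k * \<delta>))"
        unfolding power_mult_distrib[of _ "exp (- \<delta>)"] eq by (simp add: exp_of_nat_mult[symmetric])
      finally have "(\<kappa> ^ k * v ^ M) * exp (- (real k * \<delta>)) \<le> Q ^ k" .
      moreover have "(\<kappa> ^ k * v ^ M) * (1 - real k * \<delta>) \<le> (\<kappa> ^ k * v ^ M) * exp (- (real k * \<delta>))"
        using exp_ge_add_one_self[of "- (real k * \<delta>)"] \<kappa> v by (intro mult_left_mono) auto
      ultimately have "\<bar>Q ^ k - \<kappa> ^ k * v ^ M\<bar> \<le> \<kappa> ^ k * v ^ M * (real k * \<delta>)"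
        using Q1 by (simp add: algebra_simps)
      moreover have "F v - G v = exp (- (y * d)) * exp (- (y * v)) * (Q ^ k - \<kappa> ^ k * v ^ M)"
        using 3 d v unfolding F_def G_def e_def w_def Q_def
        by (simp add: algebra_simps exp_add[symmetric])
      ultimately have "\<bar>F v - G v\<bar> \<le> exp (- (y * d)) * exp (- (y * v)) * (\<kappa> ^ k * v ^ M * (real k * \<delta>))"
        by (simp add: abs_mult mult_left_mono)
      also have "\<dots> = w * (real k * (144 * real m ^ 3)) * (exp (- (y * v)) * (v ^ M * (1 / v - 1 / N)\<^sup>2))"
        by (simp add: w_def \<delta>_def mult_ac)
      also have "v ^ M * (1 / v - 1 / N)\<^sup>2 = v ^ (M - 2) * (1 - v / N)\<^sup>2"
      proof -
        obtain r where r: "M = r + 2" using M le_Suc_ex by (metis add.commute)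
        have "v * (1 / v - 1 / N) = 1 - v / N" using v by (simp add: algebra_simps)
        then have "(1 - v / N)\<^sup>2 = v\<^sup>2 * (1 / v - 1 / N)\<^sup>2" by (metis power_mult_distrib)
        then show ?thesis unfolding r by (simp add: power_add power2_eq_square)
      qed
      also have "w * (real k * (144 * real m ^ 3)) * (exp (- (y * v)) * (v ^ (M - 2) * (1 - v / N)\<^sup>2)) = E v"
        using Eeq v by simp
      also have "\<dots> \<le> B v + E v" using B0 by (simp add: B_def)
      finally show ?thesis .
    qed
  qed
  have "\<bar>laplace_poly y (p ^ k) - w * (fact M / y ^ Suc M)\<bar> \<le> B0 * (12 * real m + d) + IE"
  proof -
    have D: "has_bochner_integral lborel (\<lambda>v. F v - G v) (laplace_poly y (p ^ k) - w * (fact M / y ^ Suc M))"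
      by (intro has_bochner_integral_diff int_F int_G)
    have S: "has_bochner_integral lborel (\<lambda>v. B v + E v) (B0 * (12 * real m + d) + IE)"
      by (intro has_bochner_integral_add int_B int_E)
    have "norm (integral\<^sup>L lborel (\<lambda>v. F v - G v)) \<le> integral\<^sup>L lborel (\<lambda>v. norm (F v - G v))"
      by (rule integral_norm_bound)
    also have "\<dots> \<le> integral\<^sup>L lborel (\<lambda>v. B v + E v)"
      using D S bound by (intro integral_mono integrable_norm) (auto simp: has_bochner_integral_iff)
    finally show ?thesis
      using D S by (simp add: has_bochner_integral_iff)
  qed
  also have "B0 * (12 * real m + d) \<le> B0 * (18 * real m)" using B0 d by (intro mult_left_mono) auto
  finally show ?thesis unfolding B0_def IE_def w_def by simp
qed


text \<open>\<open>d\<close> and \<open>\<kappa>\<close> are chosen for the point N = m n before k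
  is fixed, so a = exp (- d / n) \<kappa> does not depend on k. The constant 8064 is 288 from the
  second-order error plus 7776 from the range of small v.\<close>

lemma laplace_poly_power_stouchard_approx:
  fixes m n :: nat
  assumes m: "m \<ge> 2" and n: "n \<ge> 1000"
  obtains a where "a > 0"
    "\<And>k. k > 0 \<Longrightarrow> \<bar>laplace_poly (real k / real n) (stouchard m ^ k) /
        (a ^ k * (fact (m * k) / (real k / real n) ^ Suc (m * k))) - 1\<bar> \<le> 8064 / real n ^ 2"
proof -
  obtain A where A: "finite A" "card A = m" "A \<subseteq> {0..6 * real m}" "stouchard m = (\<Prod>a\<in>A. [:-a, 1:])"
    using stouchard_eq_prod_bounded_roots by blast
  have N: "12 * real m \<le> real (m * n)" using m n mult_left_mono[of 12 "real n" "real m"] by (simp add: mult.commute)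
  obtain d \<kappa> where d: "0 \<le> d" "d \<le> 6 * real m" and \<kappa>: "(1 / 2) ^ m \<le> \<kappa>"
    and up: "\<And>v. 12 * real m \<le> v \<Longrightarrow> (\<Prod>a\<in>A. v + d - a) \<le> \<kappa> * v ^ m"
    and lo: "\<And>v. 12 * real m \<le> v \<Longrightarrow>
       \<kappa> * v ^ m * exp (- (144 * real m ^ 3 * (1 / v - 1 / real (m * n))\<^sup>2)) \<le> (\<Prod>a\<in>A. v + d - a)"
    using prod_roots_approx[OF A(1-3) _ N] m by (metis gr0I not_numeral_le_zero)
  have \<kappa>0: "0 < \<kappa>" using \<kappa> by (smt (verit) zero_less_power divide_pos_pos)
  show ?thesis
  proof (rule that[of "exp (- (d / real n)) * \<kappa>"])
    fix k :: nat
    assume k: "k > 0"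
    define M where "M = m * k"
    define y where "y = real k / real n"
    define w where "w = exp (- (y * d)) * \<kappa> ^ k"
    define Z where "Z = fact M / y ^ Suc M"
    have y: "y > 0" using k n by (simp add: y_def)
    have M2: "M \<ge> 2" using m k mult_le_mono[of 2 m 1 k] by (simp add: M_def)
    then obtain r where r: "M = Suc (Suc r)" by (metis add_2_eq_Suc le_Suc_ex)
    have weq: "(exp (- (d / real n)) * \<kappa>) ^ k = w"
      by (simp add: w_def y_def power_mult_distrib exp_of_nat_mult[symmetric])
    have w: "w > 0" using \<kappa>0 by (simp add: w_def)
    have Z: "Z > 0" using y by (simp add: Z_def)
    have "\<bar>laplace_poly y (stouchard m ^ k) - w * Z\<bar> \<le>
      ((18 * real m) ^ M + w * (12 * real m) ^ M) * (18 * real m) +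
      w * (real k * (144 * real m ^ 3)) *
      (fact (M - 2) / y ^ (M - 1) - 2 / real (m * n) * (fact (M - 1) / y ^ M) + 1 / (real (m * n))\<^sup>2 * Z)"
      unfolding w_def Z_def M_def y_def
      by (rule laplace_poly_error_bound[OF A m _ k d \<kappa>0 up lo]) (use n in auto)
    also have "w * (real k * (144 * real m ^ 3)) *
      (fact (M - 2) / y ^ (M - 1) - 2 / real (m * n) * (fact (M - 1) / y ^ M) + 1 / (real (m * n))\<^sup>2 * Z)
      \<le> w * Z * (288 / real n ^ 2)"
    proof -
      define t where "t = fact r / y ^ Suc r"
      have N: "real (m * n) = real M / y" using k n by (simp add: M_def y_def)
      have 1: "fact (M - 1) / y ^ M = (real M - 1) / y * t"
        by (simp add: r t_def)
      have 2: "Z = real M * (real M - 1) / y\<^sup>2 * t"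
      proof -
        have "fact M = real M * (real M - 1) * fact r" by (simp add: r algebra_simps)
        moreover have "y ^ Suc M = y\<^sup>2 * y ^ Suc r" by (simp add: r power2_eq_square)
        ultimately show ?thesis by (simp add: Z_def t_def)
      qed
      have "fact (M - 2) / y ^ (M - 1) - 2 / real (m * n) * (fact (M - 1) / y ^ M) + 1 / (real (m * n))\<^sup>2 * Z
          = t - 2 * y / real M * ((real M - 1) / y * t) + (y / real M)\<^sup>2 * (real M * (real M - 1) / y\<^sup>2 * t)"
        unfolding 1 2 N by (simp add: t_def r power_divide)
      \<comment> \<open>Here the choice N = M / y pays off: 1 - 2 (M - 1)/M + (M - 1)/M = 1/M,
        although each term alone is of order 1.\<close>
      also have "\<dots> = t / real M"
        using y M2 by (simp add: field_simps power2_eq_square)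
      also have "\<dots> = Z * (y\<^sup>2 / ((real M)\<^sup>2 * (real M - 1)))"
        unfolding 2 using y M2 by (simp add: field_simps power2_eq_square)
      finally have eq: "w * (real k * (144 * real m ^ 3)) * (fact (M - 2) / y ^ (M - 1) - 2 / real (m * n) * (fact (M - 1) / y ^ M) + 1 / (real (m * n))\<^sup>2 * Z)
          = w * Z * (real k * (144 * real m ^ 3) * (y\<^sup>2 / ((real M)\<^sup>2 * (real M - 1))))" by simp
      have "real k * (144 * real m ^ 3) * (y\<^sup>2 / ((real M)\<^sup>2 * (real M - 1))) =
          144 * (real M / (real M - 1)) / real n ^ 2"
      proof -
        have "real M = real m * real k" by (simp add: M_def)
        moreover have "real M - 1 \<noteq> 0" using M2 by simp
        ultimately show ?thesis using m k n
          by (simp add: y_def power2_eq_square power3_eq_cube field_simps)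
      qed
      also have "\<dots> \<le> 288 / real n ^ 2"
        using M2 by (intro divide_right_mono) (auto simp: field_simps)
      finally show ?thesis unfolding eq using w Z by (intro mult_left_mono) auto
    qed
    also have "((18 * real m) ^ M + w * (12 * real m) ^ M) * (18 * real m) \<le> w * Z * (7776 / real n ^ 2)"
    proof -
      \<comment> \<open>The main term may be small, but w >= 4^-M: one factor 2^-M comes from
        \<open>\<kappa>\<close>, the other from y d <= M / 2.\<close>
      have "(1 / 2 :: real) ^ M \<le> exp (- (1 / 2)) ^ M"
        using exp_ge_add_one_self[of "- (1 / 2)"] by (intro power_mono) auto
      also have "exp (- (1 / 2)) ^ M = exp (- (real M / 2))" by (simp add: exp_of_nat_mult[symmetric])
      also have "\<dots> \<le> exp (- (y * d))"
      proof -
        have "y * d \<le> real k / real n * (6 * real m)"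
          unfolding y_def using d by (intro mult_left_mono) auto
        also have "\<dots> = 6 * real M / real n" by (simp add: M_def)
        also have "\<dots> \<le> 6 * real M / 12" using n by (intro divide_left_mono) auto
        finally show ?thesis by simp
      qed
      finally have "(1 / 2) ^ M * (1 / 2) ^ M \<le> w"
        unfolding w_def using \<kappa> by (intro mult_mono) (auto simp: M_def power_mult intro: power_mono)
      then have w4: "(1 / 4) ^ M \<le> w" by (simp add: power_mult_distrib[symmetric])
      have "1 \<le> 4 ^ M * w" using w4 by (simp add: power_divide field_simps)
      moreover have "w \<le> 4 ^ M * w" using w by simp
      ultimately have "1 + w \<le> w * (2 * 4 ^ M)" by (simp add: algebra_simps)
      have "(12 * real m) ^ M \<le> (18 * real m) ^ M" by (intro power_mono) auto
      then have "((18 * real m) ^ M + w * (12 * real m) ^ M) * (18 * real m) \<le> ((1 + w) * (18 * real m) ^ M) * (18 * real m)"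
        using w by (intro mult_right_mono) (auto simp: distrib_right)
      also have "\<dots> \<le> ((w * (2 * 4 ^ M)) * (18 * real m) ^ M) * (18 * real m)"
        using \<open>1 + w \<le> w * (2 * 4 ^ M)\<close> by (intro mult_right_mono) auto
      also have "\<dots> = w * (36 * real m * (4 * (18 * real m)) ^ M)"
        unfolding power_mult_distrib[of 4] by (simp add: mult_ac del: power_mult_distrib)
      also have "4 * (18 * real m) = 72 * real m" by simp
      \<comment> \<open>Multiplied by y^M, the power is (72 M / n)^M <= (216 / n)^M M!. One factor
        216 / n and the 1 / n of M / n are kept; the remaining M - 1 factors are at most 1/2 and
        absorb M.\<close>
      also have "36 * real m * (72 * real m) ^ M \<le> Z * (7776 / real n ^ 2)"
      proof -
        have "real M \<le> 2 ^ (M - 1)" unfolding r by (induction r) auto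
        then have M1: "real M * (1 / 2) ^ (M - 1) \<le> 1" by (simp add: power_divide)
        have "36 * real m * (72 * real m) ^ M * y ^ Suc M = 36 * (real M / real n) * ((72 / real n) ^ M * real M ^ M)"
          by (simp add: y_def M_def power_mult_distrib power_divide)
        also have "\<dots> \<le> 36 * (real M / real n) * ((72 / real n) ^ M * (3 ^ M * fact M))"
          using power_le_exp_fact by (intro mult_left_mono) auto
        also have "\<dots> = 36 * (real M / real n) * (72 / real n * 3) ^ M * fact M"
          unfolding power_mult_distrib[of _ 3] by (simp add: mult_ac del: power_mult_distrib)
        also have "72 / real n * 3 = 216 / real n" by simp
        also have "(216 / real n) ^ M = 216 / real n * (216 / real n) ^ (M - 1)" by (simp add: r)
        also have "36 * (real M / real n) * (216 / real n * (216 / real n) ^ (M - 1)) * fact M \<le>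
            36 * (real M / real n) * (216 / real n * (1 / 2) ^ (M - 1)) * fact M"
          using n by (intro mult_right_mono mult_left_mono power_mono) auto
        also have "\<dots> = 7776 / real n ^ 2 * (real M * (1 / 2) ^ (M - 1)) * fact M"
          by (simp add: power2_eq_square)
        also have "\<dots> \<le> 7776 / real n ^ 2 * 1 * fact M"
          using M1 by (intro mult_right_mono mult_left_mono) auto
        finally have "36 * real m * (72 * real m) ^ M \<le> 7776 / real n ^ 2 * 1 * fact M / y ^ Suc M"
          using y by (simp only: pos_le_divide_eq zero_less_power)
        then show ?thesis by (simp add: Z_def mult_ac)
      qed
      finally show ?thesis using w by (simp add: mult.assoc mult_left_mono)
    qed
    finally have "\<bar>laplace_poly y (stouchard m ^ k) - w * Z\<bar> \<le> w * Z * (8064 / real n ^ 2)"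
      by (simp add: algebra_simps)
    moreover have "laplace_poly y (stouchard m ^ k) / (w * Z) - 1 =
        (laplace_poly y (stouchard m ^ k) - w * Z) / (w * Z)"
      using w Z by (simp add: diff_divide_distrib)
    ultimately have "\<bar>laplace_poly y (stouchard m ^ k) / (w * Z) - 1\<bar> \<le> 8064 / real n ^ 2"
      using w Z by (simp add: abs_mult pos_divide_le_eq mult_ac)
    then show "\<bar>laplace_poly (real k / real n) (stouchard m ^ k) /
        ((exp (- (d / real n)) * \<kappa>) ^ k * (fact (m * k) / (real k / real n) ^ Suc (m * k))) - 1\<bar> \<le> 8064 / real n ^ 2"
      unfolding weq Z_def M_def y_def .
  qed (use \<kappa>0 in auto)
qed

section \<open>The Laplace transform of a single factor\<close>

text \<open>The linear map replacing each power by a rising factorial. It converts the transform of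
  a polynomial into a power series in 1 - y.\<close>

definition rising_eval :: "real poly \<Rightarrow> real \<Rightarrow> real" where
  "rising_eval p x = (\<Sum>k\<le>degree p. coeff p k * pochhammer x k)"

lemma rising_eval_altdef:
  "degree p \<le> n \<Longrightarrow> rising_eval p x = (\<Sum>k\<le>n. coeff p k * pochhammer x k)"
  unfolding rising_eval_def by (intro sum.mono_neutral_left) (auto simp: coeff_eq_0)

text \<open>The expansion of x^m in rising factorials has exactly the signed Stirling numbers as
  coefficients. The induction uses that x times the k-th rising factorial is the (k+1)-st minus k
  times the k-th.\<close>

lemma rising_eval_stouchard: "rising_eval (stouchard m) x = x ^ m"
proof (induction m)
  case 0
  then show ?case by (simp add: rising_eval_def)
next
  case (Suc m)
  let ?p = "stouchard m"
  have deg: "degree (stouchard (Suc m)) \<le> Suc (Suc m)" by simp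
  have "rising_eval (stouchard (Suc m)) x = (\<Sum>k\<le>Suc m. (coeff ?p k - real (Suc k) * coeff ?p (Suc k)) * pochhammer x (Suc k))"
    unfolding rising_eval_altdef[OF deg]
    by (subst sum.atMost_Suc_shift) (simp add: stouchard.simps coeff_pCons coeff_pderiv)
  also have "\<dots> = (\<Sum>k\<le>Suc m. coeff ?p k * pochhammer x (Suc k)) -
      (\<Sum>k\<le>Suc m. real (Suc k) * coeff ?p (Suc k) * pochhammer x (Suc k))"
    by (simp add: sum_subtractf left_diff_distrib)
  also have "(\<Sum>k\<le>Suc m. real (Suc k) * coeff ?p (Suc k) * pochhammer x (Suc k)) =
      (\<Sum>k\<le>Suc (Suc m). real k * coeff ?p k * pochhammer x k)"
    by (subst (2) sum.atMost_Suc_shift) simp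
  also have "\<dots> = (\<Sum>k\<le>Suc m. real k * coeff ?p k * pochhammer x k)"
    by (simp add: coeff_eq_0)
  also have "(\<Sum>k\<le>Suc m. coeff ?p k * pochhammer x (Suc k)) - \<dots> = (\<Sum>k\<le>Suc m. x * (coeff ?p k * pochhammer x k))"
    unfolding sum_subtractf[symmetric] by (intro sum.cong refl) (simp add: pochhammer_Suc algebra_simps)
  also have "\<dots> = x * rising_eval ?p x"
    by (subst rising_eval_altdef[of _ "Suc m"]) (simp_all add: sum_distrib_left del: sum.atMost_Suc)
  finally show ?case using Suc by simp
qed

text \<open>The negative binomial series of (1 - (1 - y))^(- k - 1), multiplied by k!.\<close>

lemma pochhammer_power_sums:
  assumes "0 < y" "y < (1 :: real)"
  shows "(\<lambda>j. pochhammer (real (Suc j)) k * (1 - y) ^ j) sums (fact k / y ^ Suc k)"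
proof -
  have "(\<lambda>j. ((- real (Suc k)) gchoose j) * (- (1 - y)) ^ j) sums (1 + - (1 - y)) powr (- real (Suc k))"
    using assms by (intro gen_binomial_real) auto
  then have "(\<lambda>j. fact k * (((- real (Suc k)) gchoose j) * (- (1 - y)) ^ j)) sums (fact k * (1 + - (1 - y)) powr (- real (Suc k)))"
    by (rule sums_mult)
  moreover have "fact k * (((- real (Suc k)) gchoose j) * (- (1 - y)) ^ j) = pochhammer (real (Suc j)) k * (1 - y) ^ j" for j
  proof -
    have "real (Suc k) + real j - 1 = real (k + j)" by simp
    then have g: "((- real (Suc k)) gchoose j) = (-1) ^ j * (real (k + j) gchoose j)"
      using gbinomial_minus[of "real (Suc k)" j] by metis
    have "(real (k + j) gchoose j) = real ((k + j) choose j)"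
      by (rule binomial_gbinomial[symmetric])
    also have "\<dots> = fact (k + j) / (fact j * fact k)"
      by (subst binomial_fact) auto
    also have "fact (k + j) = fact j * pochhammer (real (Suc j)) k"
      using pochhammer_product'[of "1 :: real" j k] by (simp add: pochhammer_fact[symmetric] add.commute)
    finally have c: "fact k * (real (k + j) gchoose j) = pochhammer (real (Suc j)) k" by simp
    have "fact k * (((- real (Suc k)) gchoose j) * (- (1 - y)) ^ j) =
        (fact k * (real (k + j) gchoose j)) * ((-1) ^ j * (- (1 - y)) ^ j)"
      unfolding g by (simp only: mult_ac)
    also have "(-1) ^ j * (- (1 - y)) ^ j = (1 - y) ^ j"
      by (simp add: power_mult_distrib[symmetric])
    finally show ?thesis unfolding c .
  qed
  moreover have "fact k * (1 + - (1 - y)) powr (- real (Suc k)) = fact k / y ^ Suc k"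
    using assms by (simp add: powr_minus powr_realpow divide_inverse del: of_nat_Suc power_Suc)
  ultimately show ?thesis by simp
qed

lemma rising_eval_sums_laplace_poly:
  assumes "0 < y" "y < 1"
  shows "(\<lambda>j. rising_eval p (real (Suc j)) * (1 - y) ^ j) sums laplace_poly y p"
proof -
  have "(\<lambda>j. \<Sum>k\<le>degree p. coeff p k * (pochhammer (real (Suc j)) k * (1 - y) ^ j)) sums
      (\<Sum>k\<le>degree p. coeff p k * (fact k / y ^ Suc k))"
    by (intro sums_sum sums_mult pochhammer_power_sums assms)
  then show ?thesis by (simp add: rising_eval_def laplace_poly_def sum_distrib_right mult.assoc)
qed

lemma power_sums_laplace_poly_stouchard:
  assumes "0 < y" "y < 1"
  shows "(\<lambda>j. real (Suc j) ^ m * (1 - y) ^ j) sums laplace_poly y (stouchard m)"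
  using rising_eval_sums_laplace_poly[OF assms, of "stouchard m"] by (simp add: rising_eval_stouchard)

section \<open>Gamma integrals and the trapezoid rule\<close>

primrec Gamma_antideriv :: "real \<Rightarrow> nat \<Rightarrow> real \<Rightarrow> real" where
  "Gamma_antideriv L 0 t = - exp (- (L * t)) / L"
| "Gamma_antideriv L (Suc k) t =
     - (t ^ Suc k * exp (- (L * t))) / L + real (Suc k) / L * Gamma_antideriv L k t"

lemma DERIV_Gamma_antideriv:
  assumes "L > 0"
  shows "(Gamma_antideriv L k has_real_derivative t ^ k * exp (- (L * t))) (at t)"
proof (induction k)
  case 0
  have "(\<lambda>t. - exp (- (L * t)) / L) = Gamma_antideriv L 0" by (simp add: fun_eq_iff)
  moreover have "((\<lambda>t. - exp (- (L * t)) / L) has_real_derivative t ^ 0 * exp (- (L * t))) (at t)"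
    using assms by (auto intro!: derivative_eq_intros)
  ultimately show ?case by simp
next
  case (Suc k)
  have "Gamma_antideriv L (Suc k) = (\<lambda>t. - (t ^ Suc k * exp (- (L * t))) / L + real (Suc k) / L * Gamma_antideriv L k t)"
    by (simp add: fun_eq_iff)
  moreover have "((\<lambda>t. - (t ^ Suc k * exp (- (L * t))) / L + real (Suc k) / L * Gamma_antideriv L k t)
      has_real_derivative t ^ Suc k * exp (- (L * t))) (at t)"
    using assms by (auto intro!: derivative_eq_intros Suc.IH simp: field_simps simp del: power_Suc)
  ultimately show ?case by simp
qed

text \<open>The antiderivative tends to 0 at infinity, so minus this value is the Gamma integral
  over [0, \<infinity>).\<close>

lemma Gamma_antideriv_0: "L > 0 \<Longrightarrow> Gamma_antideriv L k 0 = - fact k / L ^ Suc k"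
proof (induction k)
  case (Suc k)
  have "Gamma_antideriv L (Suc k) 0 = real (Suc k) / L * Gamma_antideriv L k 0" by simp
  then show ?case using Suc by simp
qed simp

lemma power_exp_tendsto_0: "L > 0 \<Longrightarrow> (\<lambda>n. real n ^ k * exp (- (L * real n))) \<longlonglongrightarrow> 0"
  by real_asymp

lemma Gamma_antideriv_tendsto: "L > 0 \<Longrightarrow> (\<lambda>n. Gamma_antideriv L k (real n)) \<longlonglongrightarrow> 0"
proof (induction k)
  case 0
  then show ?case using power_exp_tendsto_0[of L 0] tendsto_minus[of "\<lambda>n. exp (- (L * real n)) / L" 0]
    by (auto intro!: tendsto_divide_zero)
next
  case (Suc k)
  have "(\<lambda>n. - (real n ^ Suc k * exp (- (L * real n))) / L + real (Suc k) / L * Gamma_antideriv L k (real n)) \<longlonglongrightarrow> - 0 / L + real (Suc k) / L * 0"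
    using Suc by (intro tendsto_intros power_exp_tendsto_0) auto
  then show ?case by simp
qed

text \<open>The Peano kernel (t - a)(a + 1 - t)/2 of the trapezoid rule is at most 1/8.
  \<open>W\<close> is built by two integrations by parts so that its derivative is the kernel times
  f''. Stating the bound through an antiderivative \<open>G\<close> of a majorant makes it telescope
  over unit intervals.\<close>

lemma trapezoid_error:
  fixes f f' f'' \<Phi> G g :: "real \<Rightarrow> real"
  assumes f: "\<And>t. a \<le> t \<Longrightarrow> t \<le> a + 1 \<Longrightarrow> (f has_real_derivative f' t) (at t)"
    and f': "\<And>t. a \<le> t \<Longrightarrow> t \<le> a + 1 \<Longrightarrow> (f' has_real_derivative f'' t) (at t)"
    and \<Phi>: "\<And>t. a \<le> t \<Longrightarrow> t \<le> a + 1 \<Longrightarrow> (\<Phi> has_real_derivative f t) (at t)"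
    and G: "\<And>t. a \<le> t \<Longrightarrow> t \<le> a + 1 \<Longrightarrow> (G has_real_derivative g t) (at t)"
    and le: "\<And>t. a \<le> t \<Longrightarrow> t \<le> a + 1 \<Longrightarrow> \<bar>f'' t\<bar> \<le> g t"
  shows "\<bar>\<Phi> (a + 1) - \<Phi> a - (f a + f (a + 1)) / 2\<bar> \<le> (G (a + 1) - G a) / 8"
proof -
  define W where "W = (\<lambda>t. (t - a - 1 / 2) * f t - (t - a) * (t - a - 1) / 2 * f' t - \<Phi> t)"
  have W: "(W has_real_derivative (t - a) * (a + 1 - t) / 2 * f'' t) (at t)" if "a \<le> t" "t \<le> a + 1" for t
    unfolding W_def using that
    by (auto intro!: derivative_eq_intros f f' \<Phi> simp: field_simps)
  have b: "\<bar>(t - a) * (a + 1 - t) / 2 * f'' t\<bar> \<le> g t / 8" if "a \<le> t" "t \<le> a + 1" for t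
  proof -
    have "0 \<le> (t - a - 1 / 2)\<^sup>2" by simp
    then have "(t - a) * (a + 1 - t) / 2 \<le> 1 / 8" by (simp add: power2_eq_square algebra_simps)
    then have "\<bar>(t - a) * (a + 1 - t) / 2\<bar> * \<bar>f'' t\<bar> \<le> 1 / 8 * g t"
      using that le[OF that] by (intro mult_mono) auto
    then show ?thesis by (simp add: abs_mult)
  qed
  have "W a + G a / 8 \<le> W (a + 1) + G (a + 1) / 8"
  proof (rule DERIV_nonneg_imp_nondecreasing[of a "a + 1" "\<lambda>t. W t + G t / 8"])
    fix t assume t: "a \<le> t" "t \<le> a + 1"
    have "((\<lambda>t. W t + G t / 8) has_real_derivative ((t - a) * (a + 1 - t) / 2 * f'' t + g t / 8)) (at t)"
      by (intro DERIV_add DERIV_cdivide W G t)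
    then show "\<exists>y. ((\<lambda>t. W t + G t / 8) has_real_derivative y) (at t) \<and> 0 \<le> y"
      using b[OF t] unfolding abs_le_iff by (intro exI conjI) (assumption, linarith)
  qed simp
  moreover have "W a - G a / 8 \<ge> W (a + 1) - G (a + 1) / 8"
  proof (rule DERIV_nonpos_imp_nonincreasing[of a "a + 1" "\<lambda>t. W t - G t / 8"])
    fix t assume t: "a \<le> t" "t \<le> a + 1"
    have "((\<lambda>t. W t - G t / 8) has_real_derivative ((t - a) * (a + 1 - t) / 2 * f'' t - g t / 8)) (at t)"
      by (intro DERIV_diff DERIV_cdivide W G t)
    then show "\<exists>y. ((\<lambda>t. W t - G t / 8) has_real_derivative y) (at t) \<and> y \<le> 0"
      using b[OF t] unfolding abs_le_iff by (intro exI conjI) (assumption, linarith)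
  qed simp
  moreover have "\<Phi> (a + 1) - \<Phi> a - (f a + f (a + 1)) / 2 = W a - W (a + 1)"
    by (simp add: W_def field_simps)
  ultimately show ?thesis by (simp only: abs_le_iff diff_divide_distrib) linarith
qed

text \<open>The second derivative of t^m e^(-L t) is t^(m-2) e^(-L t) ((m - L t)^2 - m); changing
  the last sign to plus gives a majorant whose integral is exactly 2 m (m - 2)! / L^(m-1). Relative
  to m! / L^(m+1) this saves the factor L^2.\<close>

lemma power_exp_sum_approx:
  assumes L: "L > 0" and m: "m \<ge> 2"
    and S: "(\<lambda>j. real (Suc j) ^ m * exp (- (L * real (Suc j)))) sums S"
  shows "\<bar>S - fact m / L ^ Suc m\<bar> \<le> L\<^sup>2 / 4 * (fact m / L ^ Suc m)"
proof -
  obtain r where r: "m = Suc (Suc r)" using m by (metis add_2_eq_Suc le_Suc_ex)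
  define f where "f = (\<lambda>t. t ^ m * exp (- (L * t)))"
  define f' where "f' = (\<lambda>t. exp (- (L * t)) * (real m * t ^ Suc r - L * t ^ m))"
  define f'' where "f'' = (\<lambda>t. t ^ r * exp (- (L * t)) * ((real m - L * t)\<^sup>2 - real m))"
  define g where "g = (\<lambda>t. t ^ r * exp (- (L * t)) * ((real m - L * t)\<^sup>2 + real m))"
  define G where "G = (\<lambda>t. (real m ^ 2 + real m) * Gamma_antideriv L r t -
      2 * real m * L * Gamma_antideriv L (Suc r) t + L\<^sup>2 * Gamma_antideriv L m t)"
  have f: "(f has_real_derivative f' t) (at t)" for t
    unfolding f_def f'_def r by (rule derivative_eq_intros refl)+ (simp add: algebra_simps)
  have f': "(f' has_real_derivative f'' t) (at t)" for t
    unfolding f'_def f''_def r by (rule derivative_eq_intros refl)+ (simp add: algebra_simps power2_eq_square)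
  have G: "(G has_real_derivative g t) (at t)" for t
    unfolding G_def g_def
    by (rule derivative_eq_intros DERIV_Gamma_antideriv[OF L] refl)+
       (simp add: r algebra_simps power2_eq_square)
  have step: "\<bar>Gamma_antideriv L m (real j + 1) - Gamma_antideriv L m (real j) - (f (real j) + f (real j + 1)) / 2\<bar>
      \<le> (G (real j + 1) - G (real j)) / 8" for j :: nat
  proof (rule trapezoid_error[where f' = f' and f'' = f'' and g = g])
    fix t assume "real j \<le> t"
    then have "t ^ r * exp (- (L * t)) \<ge> 0" by simp
    moreover have "\<bar>(real m - L * t)\<^sup>2 - real m\<bar> \<le> (real m - L * t)\<^sup>2 + real m" by (simp add: abs_le_iff)
    ultimately show "\<bar>f'' t\<bar> \<le> g t" unfolding f''_def g_def abs_mult[of "t ^ r * exp (- (L * t))"]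
      by (simp only: abs_of_nonneg mult_left_mono)
  qed (use f f' G DERIV_Gamma_antideriv[OF L] in \<open>auto simp: f_def\<close>)
  \<comment> \<open>f 0 = 0, so the lower endpoint leaves no correction, and the half term at the
    upper endpoint disappears in the limit.\<close>
  have tel: "\<bar>Gamma_antideriv L m (real n) - Gamma_antideriv L m 0 - ((\<Sum>j<n. f (real (Suc j))) - f (real n) / 2)\<bar>
      \<le> (G (real n) - G 0) / 8" for n
  proof (induction n)
    case 0
    then show ?case by (simp add: f_def r)
  next
    case (Suc n)
    have n: "real (Suc n) = real n + 1" by simp
    show ?case
      using Suc step[of n] unfolding sum.lessThan_Suc n abs_le_iff diff_divide_distrib add_divide_distrib
      by linarith
  qed
  have f0: "(\<lambda>n. f (real n)) \<longlonglongrightarrow> 0" unfolding f_def by (rule power_exp_tendsto_0[OF L])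
  have sumf: "(\<lambda>n. \<Sum>j<n. f (real (Suc j))) \<longlonglongrightarrow> S"
    using S by (simp add: f_def sums_def)
  have "(\<lambda>n. \<bar>Gamma_antideriv L m (real n) - Gamma_antideriv L m 0 - ((\<Sum>j<n. f (real (Suc j))) - f (real n) / 2)\<bar>)
      \<longlonglongrightarrow> \<bar>0 - Gamma_antideriv L m 0 - (S - 0 / 2)\<bar>"
    by (intro tendsto_intros Gamma_antideriv_tendsto[OF L] sumf f0) simp
  moreover have "(\<lambda>n. (G (real n) - G 0) / 8) \<longlonglongrightarrow>
      ((real m ^ 2 + real m) * 0 - 2 * real m * L * 0 + L\<^sup>2 * 0 - G 0) / 8"
    unfolding G_def by (intro tendsto_intros Gamma_antideriv_tendsto[OF L]) simp
  ultimately have "\<bar>0 - Gamma_antideriv L m 0 - (S - 0 / 2)\<bar> \<le> ((real m ^ 2 + real m) * 0 - 2 * real m * L * 0 + L\<^sup>2 * 0 - G 0) / 8"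
    by (rule LIMSEQ_le) (use tel in auto)
  then have "\<bar>S - fact m / L ^ Suc m\<bar> \<le> - G 0 / 8"
    using Gamma_antideriv_0[OF L, of m] by (simp add: abs_minus_commute del: power_Suc)
  also have "- G 0 = 2 * real m * fact r / L ^ Suc r"
    unfolding G_def Gamma_antideriv_0[OF L] using L by (simp add: r field_simps power2_eq_square)
  also have "2 * real m * fact r / L ^ Suc r / 8 \<le> L\<^sup>2 / 4 * (fact m / L ^ Suc m)"
  proof -
    have "L\<^sup>2 / 4 * (fact m / L ^ Suc m) = (real r + 1) * (2 * real m * fact r / L ^ Suc r / 8)"
      using L by (simp add: r field_simps power2_eq_square)
    moreover have "1 * (2 * real m * fact r / L ^ Suc r / 8) \<le> (real r + 1) * (2 * real m * fact r / L ^ Suc r / 8)"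
      using L by (intro mult_right_mono) auto
    ultimately show ?thesis by simp
  qed
  finally show ?thesis .
qed

text \<open>The extra factor 1 - y turns (1 - y)^j into e^(-L (j+1)), aligning the exponent with the
  base j + 1 of the power.\<close>

lemma laplace_poly_stouchard_approx:
  assumes y: "0 < y" "y < 1" and m: "m \<ge> 2"
  defines "L \<equiv> - ln (1 - y)"
  shows "\<bar>laplace_poly y (stouchard m) * (1 - y) / (fact m / L ^ Suc m) - 1\<bar> \<le> L\<^sup>2 / 4"
proof -
  have L: "L > 0" using y by (simp add: L_def)
  have eL: "exp (- (L * real j)) = (1 - y) ^ j" for j
  proof -
    have "exp (- (L * real j)) = exp (ln (1 - y)) ^ j" by (simp add: L_def exp_of_nat2_mult[symmetric])
    then show ?thesis using y by simp
  qed
  have "(\<lambda>j. (real (Suc j) ^ m * (1 - y) ^ j) * (1 - y)) sums (laplace_poly y (stouchard m) * (1 - y))"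
    by (intro sums_mult2 power_sums_laplace_poly_stouchard y)
  then have "(\<lambda>j. real (Suc j) ^ m * exp (- (L * real (Suc j)))) sums (laplace_poly y (stouchard m) * (1 - y))"
    unfolding eL by (simp add: mult_ac)
  note bound = power_exp_sum_approx[OF L m this]
  define Z where "Z = fact m / L ^ Suc m"
  have Z: "Z > 0" using L by (simp add: Z_def)
  have "laplace_poly y (stouchard m) * (1 - y) / Z - 1 = (laplace_poly y (stouchard m) * (1 - y) - Z) / Z"
    using Z by (simp add: diff_divide_distrib)
  then show ?thesis using bound Z unfolding Z_def[symmetric] by (simp add: pos_divide_le_eq)
qed

section \<open>The coefficients of the expansion\<close>

text \<open>This is the Adams--Bashforth coefficient: the integral over \<open>[0, 1]\<close> of \<open>pochhammer s i / fact i\<close>.\<close>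

definition adams_coeff :: "nat \<Rightarrow> real" where
  "adams_coeff i = (\<Sum>k\<le>i. real (stirling i k) / real (Suc k)) / fact i"

lemma pochhammer_le_fact:
  assumes "0 \<le> s" "s \<le> (1 :: real)"
  shows "pochhammer s i \<le> fact i"
proof -
  have "pochhammer s i \<le> pochhammer 1 i"
    unfolding pochhammer_prod using assms by (intro prod_mono) auto
  then show ?thesis by (simp add: pochhammer_fact)
qed

text \<open>For s in [0, 1] the coefficients of the binomial series lie in [0, 1], so the tail is at
  most a geometric one, uniformly in s; z <= 1/2 gives the factor 2.\<close>

lemma powr_minus_expansion:
  assumes s: "0 \<le> s" "s \<le> (1 :: real)" and z: "0 < z" "z \<le> 1 / 2"
  shows "\<bar>(1 - z) powr (- s) - (\<Sum>i\<le>J. pochhammer s i / fact i * z ^ i)\<bar> \<le> 2 * z ^ Suc J"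
proof -
  define t where "t = (\<lambda>i. pochhammer s i / fact i * z ^ i)"
  have "(\<lambda>i. ((- s) gchoose i) * (- z) ^ i) sums (1 + - z) powr (- s)"
    using z by (intro gen_binomial_real) auto
  moreover have "((- s) gchoose i) * (- z) ^ i = t i" for i
  proof -
    have "(-1) ^ i * (- z) ^ i = z ^ i" by (simp add: power_mult_distrib[symmetric])
    then show ?thesis by (simp add: gbinomial_pochhammer t_def) 
  qed
  ultimately have sums: "t sums (1 - z) powr (- s)" by simp
  have t0: "0 \<le> t i" and t1: "t i \<le> z ^ i" for i
    using pochhammer_le_fact[OF s, of i] s z mult_right_mono[of "pochhammer s i / fact i" 1 "z ^ i"]
    by (auto simp: t_def pochhammer_prod intro!: divide_nonneg_nonneg mult_nonneg_nonneg prod_nonneg)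
  have tail: "(\<lambda>i. t (i + Suc J)) sums ((1 - z) powr (- s) - (\<Sum>i<Suc J. t i))"
    using sums by (rule sums_split_initial_segment)
  have geo: "(\<lambda>i. z ^ Suc J * z ^ i) sums (z ^ Suc J * (1 / (1 - z)))"
    using z by (intro sums_mult geometric_sums) auto
  have "0 \<le> (1 - z) powr (- s) - (\<Sum>i<Suc J. t i)"
    using sums_le[OF _ sums_zero tail] t0 by auto
  moreover have "(1 - z) powr (- s) - (\<Sum>i<Suc J. t i) \<le> z ^ Suc J * (1 / (1 - z))"
  proof (rule sums_le[OF _ tail geo])
    show "t (i + Suc J) \<le> z ^ Suc J * z ^ i" for i
      using t1[of "i + Suc J"] by (simp add: power_add mult_ac)
  qed
  moreover have "z ^ Suc J * (1 / (1 - z)) \<le> z ^ Suc J * 2"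
    using z by (intro mult_left_mono) (auto simp: field_simps)
  ultimately show ?thesis by (simp add: t_def lessThan_Suc_atMost)
qed

text \<open>The preceding expansion averaged over s in [0, 1]. The mean value theorem for the
  explicit antiderivative \<open>\<Psi>\<close> replaces integration.\<close>

lemma adams_expansion:
  assumes z: "0 < z" "z \<le> (1 / 2 :: real)"
  shows "\<bar>z / ((1 - z) * - ln (1 - z)) - (\<Sum>i\<le>J. adams_coeff i * z ^ i)\<bar> \<le> 2 * z ^ Suc J"
proof -
  define L where "L = - ln (1 - z)"
  have L: "L > 0" using z by (simp add: L_def)
  define \<Psi> where "\<Psi> = (\<lambda>s. exp (L * s) / L -
     (\<Sum>i\<le>J. (\<Sum>k\<le>i. real (stirling i k) * (s ^ Suc k / real (Suc k))) / fact i * z ^ i))"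
  have "(\<Psi> has_real_derivative exp (L * s) - (\<Sum>i\<le>J. (\<Sum>k\<le>i. real (stirling i k) * s ^ k) / fact i * z ^ i)) (at s)" for s
  proof -
    have "((\<lambda>s. s ^ Suc k / real (Suc k)) has_real_derivative s ^ k) (at s)" for k
      using DERIV_cdivide[OF DERIV_pow[of "Suc k" s], of "real (Suc k)"] by (simp del: of_nat_Suc)
    then show ?thesis unfolding \<Psi>_def using L
      by (intro DERIV_diff DERIV_sum DERIV_cmult_right DERIV_cdivide DERIV_cmult)
         (auto intro!: derivative_eq_intros)
  qed
  moreover have "exp (L * s) = (1 - z) powr (- s)" for s
    using z by (simp add: powr_def L_def)
  ultimately have deriv: "(\<Psi> has_real_derivative (1 - z) powr (- s) - (\<Sum>i\<le>J. pochhammer s i / fact i * z ^ i)) (at s)" for s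
    by (simp add: stirling_pochhammer)
  obtain s where s: "0 < s" "s < 1"
    "\<Psi> 1 - \<Psi> 0 = (1 - 0) * ((1 - z) powr (- s) - (\<Sum>i\<le>J. pochhammer s i / fact i * z ^ i))"
    using MVT2[of 0 1 \<Psi>, OF _ deriv] by auto
  have "\<bar>\<Psi> 1 - \<Psi> 0\<bar> \<le> 2 * z ^ Suc J"
    unfolding s(3) using powr_minus_expansion[of s z J] s(1,2) z by simp
  moreover have "\<Psi> 1 - \<Psi> 0 = z / ((1 - z) * L) - (\<Sum>i\<le>J. adams_coeff i * z ^ i)"
  proof -
    have eL: "exp L = 1 / (1 - z)" using z by (simp add: L_def exp_minus inverse_eq_divide)
    have "exp L - 1 = z / (1 - z)" unfolding eL using z by (simp add: field_simps)
    then have "exp L / L - 1 / L = z / ((1 - z) * L)" by (simp add: diff_divide_distrib[symmetric])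
    then show ?thesis by (simp add: \<Psi>_def adams_coeff_def)
  qed
  ultimately show ?thesis by (simp add: L_def)
qed

text \<open>Termwise integration of the preceding expansion divided by z: the derivative of the
  left-hand logarithm is 1 / ((1 - z) L) - 1 / z with L = - ln (1 - z), and
  \<open>adams_coeff 0\<close> = 1 cancels the pole.\<close>

lemma ln_minus_ln_expansion:
  assumes z: "0 < z" "z \<le> (1 / 2 :: real)"
  shows "\<bar>ln (- ln (1 - z) / z) - (\<Sum>j<J. adams_coeff (Suc j) / real (Suc j) * z ^ Suc j)\<bar> \<le> 2 * z ^ Suc J"
proof -
  define H where "H = (\<lambda>z. ln (- ln (1 - z) / z) - (\<Sum>j<J. adams_coeff (Suc j) / real (Suc j) * z ^ Suc j))"
  have H: "(H has_real_derivative (1 / ((1 - x) * - ln (1 - x)) - 1 / x - (\<Sum>j<J. adams_coeff (Suc j) * x ^ j))) (at x)"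
    if x: "0 < x" "x \<le> 1 / 2" for x
  proof -
    have L: "- ln (1 - x) > 0" using x by simp
    have "((\<lambda>z. ln (- ln (1 - z) / z)) has_real_derivative (1 / ((1 - x) * - ln (1 - x)) - 1 / x)) (at x)"
      using x L by (auto intro!: derivative_eq_intros simp: field_simps)
    moreover have "((\<lambda>z. adams_coeff (Suc j) / real (Suc j) * z ^ Suc j) has_real_derivative adams_coeff (Suc j) * x ^ j) (at x)" for j
      using DERIV_cmult[OF DERIV_pow[of "Suc j" x], of "adams_coeff (Suc j) / real (Suc j)"]
      by (simp del: of_nat_Suc)
    ultimately show ?thesis unfolding H_def by (intro DERIV_diff DERIV_sum)
  qed
  have bound: "\<bar>1 / ((1 - x) * - ln (1 - x)) - 1 / x - (\<Sum>j<J. adams_coeff (Suc j) * x ^ j)\<bar> \<le> 2 * x ^ J"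
    if x: "0 < x" "x \<le> 1 / 2" for x
  proof -
    have "x / ((1 - x) * - ln (1 - x)) - (\<Sum>i\<le>J. adams_coeff i * x ^ i) =
        x * (1 / ((1 - x) * - ln (1 - x)) - 1 / x - (\<Sum>j<J. adams_coeff (Suc j) * x ^ j))"
      using x by (simp add: sum.atMost_shift adams_coeff_def sum_distrib_left right_diff_distrib mult_ac)
    then have "x * \<bar>1 / ((1 - x) * - ln (1 - x)) - 1 / x - (\<Sum>j<J. adams_coeff (Suc j) * x ^ j)\<bar> \<le> x * (2 * x ^ J)"
      using adams_expansion[OF x, of J] x by (simp add: abs_mult mult_ac)
    then show ?thesis using x by simp
  qed
  have diff: "\<bar>H z - H w\<bar> \<le> 2 * z ^ Suc J" if w: "0 < w" "w < z" for w
  proof -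
    have "\<exists>x. w < x \<and> x < z \<and>
      H z - H w = (z - w) * (1 / ((1 - x) * - ln (1 - x)) - 1 / x - (\<Sum>j<J. adams_coeff (Suc j) * x ^ j))"
      by (rule MVT2[OF w(2) H]) (use z w in auto)
    then obtain x where x: "w < x" "x < z"
      "H z - H w = (z - w) * (1 / ((1 - x) * - ln (1 - x)) - 1 / x - (\<Sum>j<J. adams_coeff (Suc j) * x ^ j))"
      by blast
    have "\<bar>H z - H w\<bar> \<le> z * (2 * x ^ J)"
      unfolding x(3) abs_mult using x(1,2) w z bound[of x] by (intro mult_mono) auto
    also have "\<dots> \<le> z * (2 * z ^ J)"
      using x(1,2) w by (intro mult_left_mono power_mono) auto
    finally show ?thesis by simp
  qed
  \<comment> \<open>The derivative is available only for positive arguments, so 0 is reached as a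
    limit from the right.\<close>
  have "(H \<longlongrightarrow> 0 - (\<Sum>j<J. adams_coeff (Suc j) / real (Suc j) * 0 ^ Suc j)) (at_right 0)"
    unfolding H_def
  proof (intro tendsto_diff tendsto_sum tendsto_mult tendsto_const tendsto_power)
    show "((\<lambda>z :: real. ln (- ln (1 - z) / z)) \<longlongrightarrow> 0) (at_right 0)" by real_asymp
  qed (auto intro: tendsto_ident_at)
  then have "((\<lambda>w. \<bar>H z - H w\<bar>) \<longlongrightarrow> \<bar>H z - 0\<bar>) (at_right 0)"
    by (intro tendsto_intros) simp
  moreover have "\<forall>\<^sub>F w in at_right 0. \<bar>H z - H w\<bar> \<le> 2 * z ^ Suc J"
    by (rule eventually_at_rightI[of 0 z]) (use z diff in auto)
  ultimately have "\<bar>H z - 0\<bar> \<le> 2 * z ^ Suc J"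
    by (intro tendsto_upperbound) auto
  then show ?thesis by (simp add: H_def)
qed

text \<open>Denominators are cleared within the naturals, for the sake of computability:
  \<open>Suc k\<close> divides \<open>fact (Suc (Suc j))\<close> for all k that occur, so the
  division is exact.\<close>

definition acyclic_num :: "nat \<Rightarrow> nat" where
  "acyclic_num j = (\<Sum>k\<le>Suc j. stirling (Suc j) k * (fact (Suc (Suc j)) div Suc k))"

definition acyclic_den :: "nat \<Rightarrow> nat" where
  "acyclic_den j = Suc j * fact (Suc j) * fact (Suc (Suc j))"

text \<open>Minus the Adams-Bashforth coefficient of index j + 1 divided by j + 1. Index 0 gives
  -1/2, the coefficient of m in the leading term.\<close>

definition acyclic_coeff :: "nat \<Rightarrow> rat" where
  "acyclic_coeff j = - of_nat (acyclic_num j) / of_nat (acyclic_den j)"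

lemma real_of_rat_acyclic_coeff:
  "real_of_rat (acyclic_coeff j) = - adams_coeff (Suc j) / real (Suc j)"
proof -
  have "real (acyclic_num j) = (\<Sum>k\<le>Suc j. real (stirling (Suc j) k) * (fact (Suc (Suc j)) / real (Suc k)))"
    unfolding acyclic_num_def of_nat_sum
  proof (rule sum.cong[OF refl])
    fix k assume "k \<in> {..Suc j}"
    then have "Suc k dvd fact (Suc (Suc j))" by (intro dvd_fact) auto
    then show "real (stirling (Suc j) k * (fact (Suc (Suc j)) div Suc k)) =
        real (stirling (Suc j) k) * (fact (Suc (Suc j)) / real (Suc k))"
      by (simp only: of_nat_mult real_of_nat_div of_nat_fact)
  qed
  also have "\<dots> = fact (Suc (Suc j)) * (\<Sum>k\<le>Suc j. real (stirling (Suc j) k) / real (Suc k))"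
    unfolding sum_distrib_left by (intro sum.cong refl) simp
  finally have "real (acyclic_num j) = fact (Suc (Suc j)) * (\<Sum>k\<le>Suc j. real (stirling (Suc j) k) / real (Suc k))" .
  moreover have "real (acyclic_den j) = real (Suc j) * fact (Suc j) * fact (Suc (Suc j))"
    by (simp only: acyclic_den_def of_nat_mult of_nat_fact)
  moreover have "real_of_rat (acyclic_coeff j) = - real (acyclic_num j) / real (acyclic_den j)"
    by (simp only: acyclic_coeff_def of_rat_divide of_rat_minus of_rat_of_nat_eq)
  moreover have "- (c * S) / (s * b * c) = - (S / b) / s" if "c \<noteq> 0" for b c s S :: real
    using that by simp
  ultimately show ?thesis unfolding adams_coeff_def by (simp only: fact_nonzero not_False_eq_True)
qed

text \<open>The Stirling recurrence in a form that the simplifier can run on numerals.\<close>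

lemma stirling_numeral:
  "stirling (numeral a) (numeral b) =
     pred_numeral a * stirling (pred_numeral a) (numeral b) + stirling (pred_numeral a) (pred_numeral b)"
  "stirling (numeral a) (Suc 0) = pred_numeral a * stirling (pred_numeral a) (Suc 0) + stirling (pred_numeral a) 0"
  "stirling (Suc 0) (numeral b) = stirling 0 (pred_numeral b)"
  by (simp_all add: numeral_eq_Suc)

lemma acyclic_coeff_values:
  "acyclic_coeff 0 = - 1 / 2"
  "acyclic_coeff 1 = - 5 / 24"
  "acyclic_coeff 2 = - 1 / 8"
  "acyclic_coeff 3 = - 251 / 2880"
  "acyclic_coeff 4 = - 19 / 288"
  "acyclic_coeff 5 = - 19087 / 362880"
  by (simp_all add: acyclic_coeff_def acyclic_num_def acyclic_den_def atMost_nat_numeral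
      stirling_numeral fact_numeral) (simp_all flip: numeral_2_eq_2)

section \<open>Computability of the coefficients\<close>

text \<open>\<open>total_recursive\<close> speaks of functions on lists of every length. Closure
  proofs need freedom to change values on lists of the wrong length.\<close>

definition recursive :: "nat \<Rightarrow> (nat list \<Rightarrow> nat) \<Rightarrow> bool" where
  "recursive n g \<longleftrightarrow> (\<exists>f. total_recursive n f \<and> (\<forall>xs. length xs = n \<longrightarrow> f xs = g xs))"

lemma recursive_cong:
  assumes "recursive n f" "\<And>xs. length xs = n \<Longrightarrow> f xs = g xs"
  shows "recursive n g"
  using assms unfolding recursive_def by metis

lemma recursive_proj: "i < n \<Longrightarrow> recursive n (\<lambda>xs. xs ! i)"
  unfolding recursive_def using total_recursive.proj by blast

lemma recursive_comp:
  assumes "recursive (length gs) f" "\<And>g. g \<in> set gs \<Longrightarrow> recursive n g"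
  shows "recursive n (\<lambda>xs. f (map (\<lambda>g. g xs) gs))"
proof -
  obtain f' where f': "total_recursive (length gs) f'" "\<And>xs. length xs = length gs \<Longrightarrow> f' xs = f xs"
    using assms(1) unfolding recursive_def by blast
  obtain w where w: "\<And>g. g \<in> set gs \<Longrightarrow> total_recursive n (w g) \<and> (\<forall>xs. length xs = n \<longrightarrow> w g xs = g xs)"
    using assms(2) unfolding recursive_def by metis
  have "total_recursive n (\<lambda>xs. f' (map (\<lambda>g. g xs) (map w gs)))"
    by (rule total_recursive.comp) (use f'(1) w in auto)
  moreover have "f' (map (\<lambda>g. g xs) (map w gs)) = f (map (\<lambda>g. g xs) gs)" if "length xs = n" for xs
  proof -
    have eq: "map (\<lambda>g. g xs) (map w gs) = map (\<lambda>g. g xs) gs" using w that by auto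
    show ?thesis unfolding eq by (rule f'(2)) simp
  qed
  ultimately show ?thesis unfolding recursive_def by blast
qed

lemma recursive_comp1: "recursive 1 f \<Longrightarrow> recursive n a \<Longrightarrow> recursive n (\<lambda>xs. f [a xs])"
  using recursive_comp[of "[a]" f n] by simp

lemma recursive_comp2:
  "recursive 2 f \<Longrightarrow> recursive n a \<Longrightarrow> recursive n b \<Longrightarrow> recursive n (\<lambda>xs. f [a xs, b xs])"
  using recursive_comp[of "[a, b]" f n] by (auto simp: numeral_2_eq_2)

lemma recursive_Suc: "recursive n a \<Longrightarrow> recursive n (\<lambda>xs. Suc (a xs))"
proof -
  have "recursive 1 (\<lambda>xs. Suc (hd xs))"
    unfolding recursive_def using total_recursive.succ by blast
  then show "recursive n a \<Longrightarrow> recursive n (\<lambda>xs. Suc (a xs))"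
    using recursive_comp1[of "\<lambda>xs. Suc (hd xs)" n a] by simp
qed

lemma recursive_const: "recursive n (\<lambda>xs. c)"
proof (induction c)
  case 0
  then show ?case unfolding recursive_def using total_recursive.zero by blast
next
  case (Suc c)
  then show ?case by (rule recursive_Suc)
qed

lemma recursive_prim_rec:
  assumes "recursive n f" "recursive (Suc (Suc n)) h"
  shows "recursive (Suc n) (\<lambda>xs. rec_nat (f (tl xs)) (\<lambda>k r. h (k # r # tl xs)) (hd xs))"
proof -
  obtain f' h' where f': "total_recursive n f'" "\<And>xs. length xs = n \<Longrightarrow> f' xs = f xs"
    and h': "total_recursive (Suc (Suc n)) h'" "\<And>xs. length xs = Suc (Suc n) \<Longrightarrow> h' xs = h xs"
    using assms unfolding recursive_def by blast
  have "rec_nat (f' (tl xs)) (\<lambda>k r. h' (k # r # tl xs)) y = rec_nat (f (tl xs)) (\<lambda>k r. h (k # r # tl xs)) y"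
    if "length xs = Suc n" for xs y
    using that by (induction y) (auto simp: f' h')
  then show ?thesis
    unfolding recursive_def using total_recursive.prim_rec[OF f'(1) h'(1)] by blast
qed

section \<open>Closure of the recursive functions under arithmetic\<close>

lemma recursive_add:
  assumes "recursive n a" "recursive n b"
  shows "recursive n (\<lambda>xs. a xs + b xs)"
proof -
  have "recursive (Suc 1) (\<lambda>xs. rec_nat ((\<lambda>ys. ys ! 0) (tl xs)) (\<lambda>k r. (\<lambda>zs. Suc (zs ! 1)) (k # r # tl xs)) (hd xs))"
    by (intro recursive_prim_rec recursive_Suc recursive_proj) auto
  moreover have "rec_nat y (\<lambda>k r. Suc r) x = x + y" for x y by (induction x) auto
  ultimately have "recursive 2 (\<lambda>xs. hd xs + tl xs ! 0)" by (simp add: numeral_2_eq_2)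
  from recursive_comp2[OF this assms] show ?thesis by simp
qed

lemma recursive_mult:
  assumes "recursive n a" "recursive n b"
  shows "recursive n (\<lambda>xs. a xs * b xs)"
proof -
  have "recursive (Suc 1) (\<lambda>xs. rec_nat ((\<lambda>ys. 0) (tl xs)) (\<lambda>k r. (\<lambda>zs. zs ! 1 + zs ! 2) (k # r # tl xs)) (hd xs))"
    by (intro recursive_prim_rec recursive_add recursive_const recursive_proj) auto
  moreover have "rec_nat 0 (\<lambda>k r. r + y) x = x * y" for x y :: nat by (induction x) auto
  ultimately have "recursive 2 (\<lambda>xs. hd xs * tl xs ! 0)" by (simp add: numeral_2_eq_2)
  from recursive_comp2[OF this assms] show ?thesis by simp
qed

lemma recursive_diff:
  assumes "recursive n a" "recursive n b"
  shows "recursive n (\<lambda>xs. a xs - b xs)"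
proof -
  \<comment> \<open>The predecessor: each step returns its counter and forgets the previous value.
    Truncated subtraction then iterates it.\<close>
  have "recursive (Suc 0) (\<lambda>xs. rec_nat ((\<lambda>ys. 0) (tl xs)) (\<lambda>k r. (\<lambda>zs. zs ! 0) (k # r # tl xs)) (hd xs))"
    by (intro recursive_prim_rec recursive_const recursive_proj) auto
  moreover have "rec_nat 0 (\<lambda>k r. k) x = x - 1" for x :: nat by (cases x) auto
  ultimately have pred: "recursive 1 (\<lambda>xs. hd xs - 1)" by simp
  have "recursive (Suc 1) (\<lambda>xs. rec_nat ((\<lambda>ys. ys ! 0) (tl xs)) (\<lambda>k r. (\<lambda>zs. hd [zs ! 1] - 1) (k # r # tl xs)) (hd xs))"
    by (intro recursive_prim_rec recursive_comp1[OF pred] recursive_proj) auto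
  moreover have "rec_nat y (\<lambda>k r. r - 1) x = y - x" for x y :: nat by (induction x) auto
  ultimately have "recursive 2 (\<lambda>xs. tl xs ! 0 - hd xs)" by (simp add: numeral_2_eq_2)
  from recursive_comp2[OF this assms(2,1)] show ?thesis by simp
qed

text \<open>The common core of bounded sums and products. The work is in rearranging arguments,
  since primitive recursion passes counter, accumulator and parameters in one list.\<close>

lemma recursive_bounded_iter:
  assumes b: "recursive n b" and F: "recursive (Suc n) F"
    and op: "\<And>m a c. recursive m a \<Longrightarrow> recursive m c \<Longrightarrow> recursive m (\<lambda>xs. op (a xs) (c xs))"
  shows "recursive n (\<lambda>xs. rec_nat e (\<lambda>k r. op r (F (k # xs))) (b xs))"
proof -
  \<comment> \<open>Selects the counter and the parameters, skipping the accumulator in position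
    1.\<close>
  define gs where "gs = (\<lambda>zs :: nat list. zs ! 0) # map (\<lambda>i zs. zs ! Suc (Suc i)) [0..<n]"
  have "recursive (Suc (Suc n)) (\<lambda>zs. F (map (\<lambda>g. g zs) gs))"
    by (rule recursive_comp) (use F in \<open>auto simp: gs_def intro!: recursive_proj\<close>)
  then have "recursive (Suc (Suc n)) (\<lambda>zs. op (zs ! 1) (F (map (\<lambda>g. g zs) gs)))"
    by (intro op recursive_proj) auto
  then have "recursive (Suc (Suc n)) (\<lambda>zs. op (zs ! 1) (F (hd zs # tl (tl zs))))"
  proof (rule recursive_cong)
    fix zs :: "nat list"
    assume len: "length zs = Suc (Suc n)"
    obtain z r ys where zs: "zs = z # r # ys" "length ys = n"
      using len by (cases zs; cases "tl zs") auto
    have "map (\<lambda>i. zs ! Suc (Suc i)) [0..<n] = ys" using zs map_nth[of ys] by simp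
    then have "map (\<lambda>g. g zs) gs = hd zs # tl (tl zs)" using zs by (simp add: gs_def comp_def)
    then show "op (zs ! 1) (F (map (\<lambda>g. g zs) gs)) = op (zs ! 1) (F (hd zs # tl (tl zs)))" by simp
  qed
  from recursive_prim_rec[OF recursive_const[of n e] this]
  have R: "recursive (Suc n) (\<lambda>xs. rec_nat e (\<lambda>k r. op r (F (k # tl xs))) (hd xs))" by simp
  define hs where "hs = b # map (\<lambda>i xs. xs ! i) [0..<n]"
  have "recursive n (\<lambda>xs. (\<lambda>xs. rec_nat e (\<lambda>k r. op r (F (k # tl xs))) (hd xs)) (map (\<lambda>g. g xs) hs))"
    by (rule recursive_comp) (use R b in \<open>auto simp: hs_def intro!: recursive_proj\<close>)
  then show ?thesis
  proof (rule recursive_cong)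
    fix xs :: "nat list"
    assume "length xs = n"
    then have "map (\<lambda>g. g xs) hs = b xs # xs"
      by (intro nth_equalityI) (auto simp: hs_def nth_Cons')
    then show "(\<lambda>xs. rec_nat e (\<lambda>k r. op r (F (k # tl xs))) (hd xs)) (map (\<lambda>g. g xs) hs) =
        rec_nat e (\<lambda>k r. op r (F (k # xs))) (b xs)" by simp
  qed
qed

lemma recursive_sum:
  assumes "recursive n b" "recursive (Suc n) F"
  shows "recursive n (\<lambda>xs. \<Sum>i<b xs. F (i # xs))"
proof -
  have "rec_nat 0 (\<lambda>k r. r + f k) x = sum f {..<x}" for f :: "nat \<Rightarrow> nat" and x
    by (induction x) auto
  note r = this[of "\<lambda>k. F (k # _)"]
  show ?thesis
    by (rule recursive_cong[OF recursive_bounded_iter[where op = "(+)" and e = 0, OF assms recursive_add]])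
      (simp_all only: r)
qed

lemma recursive_prod:
  assumes "recursive n b" "recursive (Suc n) F"
  shows "recursive n (\<lambda>xs. \<Prod>i<b xs. F (i # xs))"
proof -
  have "rec_nat 1 (\<lambda>k r. r * f k) x = prod f {..<x}" for f :: "nat \<Rightarrow> nat" and x
    by (induction x) auto
  note r = this[of "\<lambda>k. F (k # _)"]
  show ?thesis
    by (rule recursive_cong[OF recursive_bounded_iter[where op = "(*)" and e = 1, OF assms recursive_mult]])
      (simp_all only: r)
qed

lemma recursive_fact:
  assumes "recursive n a"
  shows "recursive n (\<lambda>xs. fact (a xs))"
proof -
  have "recursive 1 (\<lambda>xs. \<Prod>i<xs ! 0. (\<lambda>ys. Suc (ys ! 0)) (i # xs))"
    by (intro recursive_prod recursive_Suc recursive_proj) auto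
  moreover have "(\<Prod>i<x. Suc i) = fact x" for x :: nat by (induction x) auto
  ultimately have "recursive 1 (\<lambda>xs. fact (xs ! 0))" by simp
  from recursive_comp1[OF this assms] show ?thesis by simp
qed

lemma recursive_power:
  assumes "recursive n a" "recursive n b"
  shows "recursive n (\<lambda>xs. a xs ^ b xs)"
proof -
  have "recursive 2 (\<lambda>xs. \<Prod>i<xs ! 1. (\<lambda>ys. ys ! 1) (i # xs))"
    by (intro recursive_prod recursive_proj) auto
  then have "recursive 2 (\<lambda>xs. xs ! 0 ^ xs ! 1)" by simp
  from recursive_comp2[OF this assms] show ?thesis by simp
qed

lemma recursive_pochhammer:
  assumes "recursive n a" "recursive n b"
  shows "recursive n (\<lambda>xs. pochhammer (a xs) (b xs))"
proof -
  have "recursive 2 (\<lambda>xs. \<Prod>i<xs ! 1. (\<lambda>ys. ys ! 1 + ys ! 0) (i # xs))"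
    by (intro recursive_prod recursive_proj recursive_add) auto
  then have "recursive 2 (\<lambda>xs. pochhammer (xs ! 0) (xs ! 1))"
    by (simp add: pochhammer_prod atLeast0LessThan)
  from recursive_comp2[OF this assms] show ?thesis by simp
qed

text \<open>The quotient counts the i with (i + 1) b <= a, and the truncated difference is the
  indicator of this condition. Division thus reduces to bounded sums, without a search.\<close>

lemma div_eq_sum: "b > 0 \<Longrightarrow> (a :: nat) div b = (\<Sum>i<a. 1 - (Suc i * b - a))"
proof -
  assume b: "b > 0"
  have "(\<Sum>i<a. 1 - (Suc i * b - a)) = (\<Sum>i<a. if i < a div b then 1 else 0)"
  proof (rule sum.cong[OF refl])
    fix i
    have "i < a div b \<longleftrightarrow> Suc i * b \<le> a"
      using b less_eq_div_iff_mult_less_eq[of b "Suc i" a] by (simp add: Suc_le_eq)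
    then show "1 - (Suc i * b - a) = (if i < a div b then 1 else 0)" by auto
  qed
  also have "\<dots> = card ({..<a} \<inter> {i. i < a div b})"
    by (simp add: sum.If_cases)
  also have "{..<a} \<inter> {i. i < a div b} = {..<a div b}"
    by (auto intro: less_le_trans[OF _ div_le_dividend])
  finally show ?thesis by simp
qed

lemma recursive_div:
  assumes "recursive n a" "recursive n b" "\<And>xs. length xs = n \<Longrightarrow> b xs > 0"
  shows "recursive n (\<lambda>xs. a xs div b xs)"
proof -
  have "recursive 2 (\<lambda>xs. \<Sum>i<xs ! 0. (\<lambda>ys. 1 - (Suc (ys ! 0) * ys ! 2 - ys ! 1)) (i # xs))"
    by (intro recursive_sum recursive_proj recursive_diff recursive_mult recursive_Suc recursive_const) auto
  from recursive_comp2[OF this assms(1,2)] show ?thesis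
    by (rule recursive_cong) (simp add: div_eq_sum assms(3))
qed

lemma recursive_mod:
  assumes "recursive n a" "recursive n b" "\<And>xs. length xs = n \<Longrightarrow> b xs > 0"
  shows "recursive n (\<lambda>xs. a xs mod b xs)"
  unfolding modulo_nat_def
  by (intro recursive_diff recursive_mult recursive_div assms)

text \<open>Dividing by \<open>B\<close> drops the lowest digit and shifts the digit sequence by
  one.\<close>

lemma base_digit:
  fixes c :: "nat \<Rightarrow> nat"
  assumes "\<And>k. c k < B" "k \<le> n"
  shows "((\<Sum>i\<le>n. c i * B ^ i) div B ^ k) mod B = c k"
  using assms
proof (induction k arbitrary: n c)
  case 0
  have "(\<Sum>i\<le>n. c i * B ^ i) = c 0 + B * (\<Sum>i<n. c (Suc i) * B ^ i)"
    by (simp add: sum.atMost_shift sum_distrib_left mult_ac)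
  then show ?case using 0(1)[of 0] by simp
next
  case (Suc k)
  obtain n' where n: "n = Suc n'" using Suc.prems by (cases n) auto
  have "(\<Sum>i\<le>n. c i * B ^ i) = c 0 + B * (\<Sum>i\<le>n'. c (Suc i) * B ^ i)"
    by (simp add: n sum.atMost_Suc_shift sum_distrib_left mult_ac del: sum.atMost_Suc)
  moreover have "B > 0" "c 0 < B" using Suc.prems(1)[of 0] by auto
  ultimately have "(\<Sum>i\<le>n. c i * B ^ i) div B = (\<Sum>i\<le>n'. c (Suc i) * B ^ i)" by simp
  then have "(\<Sum>i\<le>n. c i * B ^ i) div B ^ Suc k = (\<Sum>i\<le>n'. c (Suc i) * B ^ i) div B ^ k"
    by (simp add: div_mult2_eq)
  then show ?case using Suc.IH[of "\<lambda>i. c (Suc i)" n'] Suc.prems n by simp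
qed

text \<open>Reading off the digits of a rising factorial avoids a two-dimensional recursion.\<close>

lemma stirling_eq_digit:
  "stirling n k = (pochhammer (Suc (fact n)) n div Suc (fact n) ^ k) mod Suc (fact n)"
proof -
  \<comment> \<open>The row sum of the Stirling numbers is n!, so the base n! + 1 exceeds every
    digit.\<close>
  have lt: "stirling n i < Suc (fact n)" for i
  proof (cases "i \<le> n")
    case True
    then have "stirling n i \<le> (\<Sum>k\<le>n. stirling n k)" by (intro member_le_sum) auto
    then show ?thesis by (simp add: sum_stirling)
  qed simp
  have "pochhammer (Suc (fact n)) n = (\<Sum>i\<le>n. stirling n i * Suc (fact n) ^ i)"
    using stirling_pochhammer[of n "Suc (fact n)"] by simp
  \<comment> \<open>Padding with zero digits covers the case k > n.\<close>
  also have "\<dots> = (\<Sum>i\<le>max n k. stirling n i * Suc (fact n) ^ i)"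
    by (rule sum.mono_neutral_left) auto
  finally show ?thesis using base_digit[of "stirling n" "Suc (fact n)" k "max n k", OF lt] by simp
qed

lemma recursive_stirling:
  assumes "recursive n a" "recursive n b"
  shows "recursive n (\<lambda>xs. stirling (a xs) (b xs))"
  unfolding stirling_eq_digit
  by (intro recursive_mod recursive_div recursive_pochhammer recursive_power recursive_Suc recursive_fact assms) auto

lemma computable_nat_seqI:
  assumes "recursive 1 (\<lambda>xs. g (xs ! 0))"
  shows "computable_nat_seq g"
proof -
  obtain f where "total_recursive 1 f" "\<And>xs. length xs = 1 \<Longrightarrow> f xs = g (xs ! 0)"
    using assms unfolding recursive_def by blast
  then show ?thesis unfolding computable_nat_seq_def by (intro exI[of _ f]) auto
qed

section \<open>The asymptotic formula\<close>

lemma computable_acyclic_coeff: "computable_rat_seq acyclic_coeff"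
proof -
  have "recursive 1 (\<lambda>xs. \<Sum>k<Suc (Suc (xs ! 0)).
      (\<lambda>ys. stirling (Suc (ys ! 1)) (ys ! 0) * (fact (Suc (Suc (ys ! 1))) div Suc (ys ! 0))) (k # xs))"
    by (intro recursive_sum recursive_mult recursive_stirling recursive_div recursive_fact
        recursive_Suc recursive_proj) auto
  then have "recursive 1 (\<lambda>xs. acyclic_num (xs ! 0))"
    unfolding acyclic_num_def by (rule recursive_cong) (simp only: lessThan_Suc_atMost nth_Cons_0 nth_Cons_Suc One_nat_def)
  moreover have "recursive 1 (\<lambda>xs. acyclic_den (xs ! 0))"
    unfolding acyclic_den_def by (intro recursive_mult recursive_fact recursive_Suc recursive_proj) auto
  \<comment> \<open>The sign exponent: \<open>acyclic_coeff\<close> always carries a minus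
    sign.\<close>
  moreover have "computable_nat_seq (\<lambda>_. 1)"
    by (rule computable_nat_seqI) (rule recursive_const)
  moreover have "acyclic_den k \<noteq> 0 \<and>
      acyclic_coeff k = (-1) ^ 1 * of_nat (acyclic_num k) / of_nat (acyclic_den k)" for k
    by (simp add: acyclic_coeff_def acyclic_den_def)
  ultimately show ?thesis
    unfolding computable_rat_seq_def by (blast intro: computable_nat_seqI)
qed

text \<open>The \<epsilon> of the theorem, obtained by solving the formula for it; only its size
  remains to be bounded.\<close>

definition log_error :: "nat \<Rightarrow> nat \<Rightarrow> nat \<Rightarrow> real" where
  "log_error J m n = ln (real (D m n)) - ln (fact (m * n)) -
     (- real m / 2 + 1 / 2 + (\<Sum>j = 1..J. real_of_rat (acyclic_coeff j) * (real m / real n ^ j)))"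

lemma D_eq_exp_log_error:
  "real (D m n) = fact (m * n) * exp (- real m / 2 + 1 / 2 +
     (\<Sum>j = 1..J. real_of_rat (acyclic_coeff j) * (real m / real n ^ j)) + log_error J m n)"
proof -
  have "exp (ln (real (D m n)) - ln (fact (m * n))) = real (D m n) / fact (m * n)"
    using D_pos[of m n] by (simp add: exp_diff)
  then show ?thesis by (simp add: log_error_def)
qed

text \<open>With parts of size 1 the graph is complete. The analytic estimates assume m >= 2, so
  this case is treated apart.\<close>

lemma D_1: "D 1 n = fact n"
proof -
  have "stouchard 1 ^ n = monom 1 n"
    by (simp add: stouchard.simps monom_altdef)
  moreover have "laplace_poly 1 (monom 1 n) = (\<Sum>k\<in>{n}. coeff (monom 1 n) k * fact k)"
    unfolding laplace_poly_def by (simp only: power_one div_by_1, rule sum.mono_neutral_right)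
      (auto simp: degree_monom_eq)
  ultimately have "real (D 1 n) = fact n" unfolding D_eq_laplace_poly by simp
  then show ?thesis by (metis of_nat_eq_iff of_nat_fact)
qed

lemma abs_log_error_1:
  assumes "n \<ge> 1"
  shows "\<bar>log_error J 1 n\<bar> \<le> (\<Sum>j = 1..J. \<bar>real_of_rat (acyclic_coeff j)\<bar>) / real n"
proof -
  have "log_error J 1 n = - (\<Sum>j = 1..J. real_of_rat (acyclic_coeff j) * (1 / real n ^ j))"
    unfolding log_error_def D_1 by simp
  then have "\<bar>log_error J 1 n\<bar> \<le> (\<Sum>j = 1..J. \<bar>real_of_rat (acyclic_coeff j) * (1 / real n ^ j)\<bar>)"
    by (simp only: abs_minus_cancel sum_abs)
  also have "\<dots> \<le> (\<Sum>j = 1..J. \<bar>real_of_rat (acyclic_coeff j)\<bar> / real n)"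
  proof (rule sum_mono)
    fix j assume "j \<in> {1..J}"
    then have "real n ^ 1 \<le> real n ^ j" using assms by (intro power_increasing) auto
    then have "1 / real n ^ j \<le> 1 / real n" using assms by (intro divide_left_mono) auto
    then have "\<bar>real_of_rat (acyclic_coeff j)\<bar> * (1 / real n ^ j) \<le> \<bar>real_of_rat (acyclic_coeff j)\<bar> * (1 / real n)"
      by (intro mult_left_mono) auto
    then show "\<bar>real_of_rat (acyclic_coeff j) * (1 / real n ^ j)\<bar> \<le> \<bar>real_of_rat (acyclic_coeff j)\<bar> / real n"
      by (simp add: abs_mult)
  qed
  finally show ?thesis by (simp add: sum_divide_distrib)
qed

lemma abs_ln_le:
  fixes x :: real
  assumes "\<bar>x - 1\<bar> \<le> 1 / 2"
  shows "\<bar>ln x\<bar> \<le> 2 * \<bar>x - 1\<bar>"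
proof -
  define e where "e = x - 1"
  have e: "\<bar>e\<bar> \<le> 1 / 2" using assms by (simp add: e_def)
  have "\<bar>ln x\<bar> \<le> \<bar>ln x - e\<bar> + \<bar>e\<bar>" using abs_triangle_ineq[of "ln x - e" e] by simp
  also have "\<bar>ln x - e\<bar> \<le> 2 * e\<^sup>2" using abs_ln_one_plus_x_minus_x_bound[OF e] by (simp add: e_def)
  also have "e\<^sup>2 = \<bar>e\<bar> * \<bar>e\<bar>" by (simp add: power2_eq_square)
  also have "\<bar>e\<bar> * \<bar>e\<bar> \<le> 1 / 2 * \<bar>e\<bar>" using e by (intro mult_right_mono) auto
  finally show ?thesis by (simp add: e_def)
qed

text \<open>The unknown a is eliminated between k = 1 and k = n. Its logarithm is multiplied by n,
  which turns the errors of order n^-2 of \<open>x1\<close> and \<open>x3\<close> into order 1/n: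
  32258 = 16128 + 16130.\<close>

lemma ln_D_approx:
  assumes m: "m \<ge> 2" and n: "n \<ge> 1000"
  defines "L \<equiv> - ln (1 - 1 / real n)"
  shows "\<bar>ln (real (D m n)) - (ln (fact (m * n)) + real n * L - real (Suc m) * real n * ln (real n * L))\<bar> \<le> 32258 / real n"
proof -
  define z where "z = 1 / real n"
  have z: "0 < z" "z \<le> 1 / 1000" using n by (auto simp: z_def field_simps)
  have L0: "L > 0" using z by (simp add: L_def z_def[symmetric])
  have Lz: "L \<le> 2 * z"
  proof -
    have "\<bar>ln (1 + - z) - - z\<bar> \<le> 2 * (- z)\<^sup>2"
      using z by (intro abs_ln_one_plus_x_minus_x_bound) auto
    moreover have "2 * (- z)\<^sup>2 \<le> z"
      using z mult_right_mono[of "2 * z" 1 z] by (simp add: power2_eq_square)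
    ultimately show ?thesis by (simp add: L_def z_def[symmetric])
  qed
  obtain a where a: "a > 0"
    "\<And>k. k > 0 \<Longrightarrow> \<bar>laplace_poly (real k / real n) (stouchard m ^ k) /
        (a ^ k * (fact (m * k) / (real k / real n) ^ Suc (m * k))) - 1\<bar> \<le> 8064 / real n ^ 2"
    using laplace_poly_power_stouchard_approx[OF m n] by blast
  define F where "F = laplace_poly z (stouchard m)"
  define Z where "Z = fact m / L ^ Suc m"
  \<comment> \<open>Three ratios close to 1: \<open>x1\<close> and \<open>x3\<close> compare the
    same \<open>F\<close> with a times a Gamma integral and with the trapezoid value, while
    \<open>x2\<close> is the case k = n, where the rate is 1.\<close>
  define x1 where "x1 = F / (a * (fact m / z ^ Suc m))"
  define x2 where "x2 = real (D m n) / (a ^ n * fact (m * n))"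
  define x3 where "x3 = F * (1 - z) / Z"
  have small: "8064 * z\<^sup>2 \<le> 1 / 2"
    using power_mono[OF z(2), of 2] z by (simp add: power2_eq_square)
  have x1: "\<bar>x1 - 1\<bar> \<le> 8064 * z\<^sup>2"
    using a(2)[of 1] by (simp add: x1_def F_def z_def power_divide)
  have x2: "\<bar>x2 - 1\<bar> \<le> 8064 * z\<^sup>2"
    using a(2)[of n] n by (simp add: x2_def z_def D_eq_laplace_poly power_divide)
  have x3: "\<bar>x3 - 1\<bar> \<le> z\<^sup>2"
  proof -
    have "\<bar>x3 - 1\<bar> \<le> L\<^sup>2 / 4"
      unfolding x3_def F_def Z_def L_def z_def[symmetric]
      using z m by (intro laplace_poly_stouchard_approx) auto
    also have "L\<^sup>2 \<le> (2 * z)\<^sup>2" using L0 Lz by (intro power_mono) auto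
    finally show ?thesis by (simp add: power_mult_distrib)
  qed
  have Z: "Z > 0" using L0 by (simp add: Z_def)
  have x3_pos: "x3 > 0" using x3 small z by (smt (verit) field_sum_of_halves zero_le_power2)
  have F: "F > 0"
    using x3_pos Z z by (simp add: x3_def zero_less_mult_iff zero_less_divide_iff)
  have ln1: "ln F = ln x1 + ln a + ln (fact m) - real (Suc m) * ln z"
  proof -
    have "ln x1 = ln F - (ln a + (ln (fact m) - real (Suc m) * ln z))"
      unfolding x1_def using F a(1) z by (simp add: ln_div ln_mult ln_realpow del: power_Suc of_nat_Suc)
    then show ?thesis by simp
  qed
  have ln2: "ln (real (D m n)) = ln x2 + real n * ln a + ln (fact (m * n))"
    unfolding x2_def using D_pos[of m n] a(1) by (simp add: ln_div ln_mult ln_realpow)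
  have ln3: "ln F = ln x3 + L + ln (fact m) - real (Suc m) * ln L"
  proof -
    have "ln x3 = ln F + ln (1 - z) - (ln (fact m) - real (Suc m) * ln L)"
      unfolding x3_def Z_def using F L0 z by (simp add: ln_div ln_mult ln_realpow del: power_Suc of_nat_Suc)
    then show ?thesis by (simp add: L_def z_def)
  qed
  have lnL: "ln (real n * L) = ln L - ln z"
    using L0 n by (simp add: z_def ln_mult ln_div)
  \<comment> \<open>Equating the two expressions for \<open>ln F\<close> cancels \<open>F\<close>
    and m!.\<close>
  have lna: "ln a = L - real (Suc m) * ln (real n * L) + ln x3 - ln x1"
    using ln1 ln3 unfolding lnL by (simp add: algebra_simps)
  have "ln (real (D m n)) - (ln (fact (m * n)) + real n * L - real (Suc m) * real n * ln (real n * L)) =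
      ln x2 + real n * (ln x3 - ln x1)"
    unfolding ln2 lna by (simp add: algebra_simps)
  also have "\<bar>\<dots>\<bar> \<le> \<bar>ln x2\<bar> + real n * (\<bar>ln x3\<bar> + \<bar>ln x1\<bar>)"
    by (rule order_trans[OF abs_triangle_ineq]) (auto simp: abs_mult intro!: mult_left_mono)
  also have "\<dots> \<le> 16128 * z\<^sup>2 + real n * (2 * z\<^sup>2 + 16128 * z\<^sup>2)"
  proof -
    have z2: "z\<^sup>2 \<le> 1 / 2" using small zero_le_power2[of z] by linarith
    have "\<bar>ln x1\<bar> \<le> 2 * \<bar>x1 - 1\<bar>" "\<bar>ln x2\<bar> \<le> 2 * \<bar>x2 - 1\<bar>" "\<bar>ln x3\<bar> \<le> 2 * \<bar>x3 - 1\<bar>"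
      by (rule abs_ln_le, use x1 x2 x3 small z2 in linarith)+
    then have "\<bar>ln x1\<bar> \<le> 16128 * z\<^sup>2" "\<bar>ln x2\<bar> \<le> 16128 * z\<^sup>2" "\<bar>ln x3\<bar> \<le> 2 * z\<^sup>2"
      using x1 x2 x3 by linarith+
    then show ?thesis by (intro add_mono mult_left_mono) auto
  qed
  also have "\<dots> = 16128 * z\<^sup>2 + 16130 * z"
    using n by (simp add: z_def power2_eq_square)
  also have "z\<^sup>2 \<le> z" using z mult_right_mono[of z 1 z] by (simp add: power2_eq_square)
  finally show ?thesis by (simp add: z_def)
qed

text \<open>The growth condition on m enters only through the remainder 2 n^-(J+1) of the expansion,
  which m multiplies; this gives the term 2 C / n.\<close>

lemma abs_log_error_large:
  assumes m: "m \<ge> 2" "real m \<le> C * real n ^ J" and n: "n \<ge> 1000"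
  shows "\<bar>log_error J m n\<bar> \<le> (32262 + 2 * C) / real n"
proof -
  define z where "z = 1 / real n"
  define L where "L = - ln (1 - z)"
  have z: "0 < z" "z \<le> 1 / 1000" using n by (auto simp: z_def field_simps)
  have zJ: "real n * (2 * z ^ Suc k) = 2 * z ^ k" for k using n by (simp add: z_def)
  have h: "ln (real n * L) = ln (- ln (1 - z) / z)" by (simp add: L_def z_def mult.commute)
  have 1: "\<bar>real n * L - 1\<bar> \<le> 2 * z"
  proof -
    have "\<bar>ln (1 + - z) - - z\<bar> \<le> 2 * (- z)\<^sup>2"
      using z by (intro abs_ln_one_plus_x_minus_x_bound) auto
    then have "\<bar>L - z\<bar> \<le> 2 * z\<^sup>2" by (simp add: L_def)
    then have "real n * \<bar>L - z\<bar> \<le> real n * (2 * z\<^sup>2)" by (intro mult_left_mono) auto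
    also have "\<dots> = 2 * z" using zJ[of 1] by (simp add: power2_eq_square)
    also have "real n * \<bar>L - z\<bar> = \<bar>real n * (L - z)\<bar>" by (simp add: abs_mult)
    also have "real n * (L - z) = real n * L - 1" using n by (simp add: z_def right_diff_distrib)
    finally show ?thesis .
  qed
  \<comment> \<open>The factor n = 1 / z lowers every power of z by one, so the Adams coefficient of
    index j + 1 meets z^j.\<close>
  have exp_h: "\<bar>real n * ln (real n * L) + (\<Sum>j<k. real_of_rat (acyclic_coeff j) * z ^ j)\<bar> \<le> 2 * z ^ k" for k
  proof -
    have "\<bar>ln (real n * L) - (\<Sum>j<k. adams_coeff (Suc j) / real (Suc j) * z ^ Suc j)\<bar> \<le> 2 * z ^ Suc k"
      unfolding h using z by (intro ln_minus_ln_expansion) auto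
    then have "real n * \<bar>ln (real n * L) - (\<Sum>j<k. adams_coeff (Suc j) / real (Suc j) * z ^ Suc j)\<bar> \<le> real n * (2 * z ^ Suc k)"
      by (intro mult_left_mono) auto
    also have "real n * \<bar>ln (real n * L) - (\<Sum>j<k. adams_coeff (Suc j) / real (Suc j) * z ^ Suc j)\<bar> =
        \<bar>real n * (ln (real n * L) - (\<Sum>j<k. adams_coeff (Suc j) / real (Suc j) * z ^ Suc j))\<bar>"
      by (simp add: abs_mult)
    also have "real n * (ln (real n * L) - (\<Sum>j<k. adams_coeff (Suc j) / real (Suc j) * z ^ Suc j)) =
        real n * ln (real n * L) + (\<Sum>j<k. real_of_rat (acyclic_coeff j) * z ^ j)"
    proof -
      have "real n * (\<Sum>j<k. adams_coeff (Suc j) / real (Suc j) * z ^ Suc j) = - (\<Sum>j<k. real_of_rat (acyclic_coeff j) * z ^ j)"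
        unfolding sum_distrib_left sum_negf[symmetric]
        using n by (intro sum.cong refl) (simp add: real_of_rat_acyclic_coeff z_def)
      then show ?thesis by (simp add: right_diff_distrib)
    qed
    finally show ?thesis unfolding zJ .
  qed
  have c0: "real_of_rat (acyclic_coeff 0) = - 1 / 2"
    unfolding acyclic_coeff_values by (simp add: of_rat_minus of_rat_divide)
  have 2: "\<bar>real n * ln (real n * L) - 1 / 2\<bar> \<le> 2 * z"
    using exp_h[of 1] by (simp add: c0)
  define S where "S = (\<Sum>j = 1..J. real_of_rat (acyclic_coeff j) * z ^ j)"
  have 3: "\<bar>real n * ln (real n * L) - 1 / 2 + S\<bar> \<le> 2 * z ^ Suc J"
  proof -
    have "(\<Sum>j<Suc J. real_of_rat (acyclic_coeff j) * z ^ j) = - 1 / 2 + S"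
      unfolding S_def lessThan_Suc_atMost atMost_atLeast0 by (subst sum.atLeast_Suc_atMost) (auto simp: c0)
    then show ?thesis using exp_h[of "Suc J"] by simp
  qed
  have 4: "\<bar>ln (real (D m n)) - (ln (fact (m * n)) + real n * L - real (Suc m) * real n * ln (real n * L))\<bar> \<le> 32258 * z"
    using ln_D_approx[OF m(1) n] by (simp add: L_def z_def)
  have 5: "\<bar>real m * (real n * ln (real n * L) - 1 / 2 + S)\<bar> \<le> 2 * C * z"
  proof -
    have "\<bar>real m * (real n * ln (real n * L) - 1 / 2 + S)\<bar> \<le> real m * (2 * z ^ Suc J)"
      using 3 by (simp only: abs_mult abs_of_nat mult_left_mono of_nat_0_le_iff)
    also have "\<dots> \<le> (C * real n ^ J) * (2 * z ^ Suc J)" using m z by (intro mult_right_mono) auto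
    also have "\<dots> = 2 * C * z" using n by (simp add: z_def power_divide)
    finally show ?thesis .
  qed
  have sum: "(\<Sum>j = 1..J. real_of_rat (acyclic_coeff j) * (real m / real n ^ j)) = real m * S"
    unfolding S_def sum_distrib_left by (intro sum.cong refl) (simp add: z_def power_divide)
  \<comment> \<open>The m + 1 copies of n ln (n L) are split: one copy needs only its leading term
    1/2, while the m others need the full expansion. Together with n L, close to 1, the single copy
    yields the summand 1/2.\<close>
  have "log_error J m n =
      (ln (real (D m n)) - (ln (fact (m * n)) + real n * L - real (Suc m) * real n * ln (real n * L))) +
      (real n * L - 1) - (real n * ln (real n * L) - 1 / 2) -
      real m * (real n * ln (real n * L) - 1 / 2 + S)"
    unfolding log_error_def sum by (simp add: algebra_simps)
  then have "\<bar>log_error J m n\<bar> \<le> 32258 * z + 2 * z + 2 * z + 2 * C * z"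
    using 1 2 4 5 by linarith
  also have "\<dots> = (32262 + 2 * C) / real n" by (simp add: z_def add_divide_distrib)
  finally show ?thesis .
qed

theorem theorem9:
  "\<exists>\<gamma> :: nat \<Rightarrow> rat.
     computable_rat_seq \<gamma> \<and>
     \<gamma> 1 = - 5 / 24 \<and> \<gamma> 2 = - 1 / 8 \<and> \<gamma> 3 = - 251 / 2880 \<and>
     \<gamma> 4 = - 19 / 288 \<and> \<gamma> 5 = - 19087 / 362880 \<and>
     (\<forall>J \<ge> 1. \<forall>C :: real. \<exists>K :: real. \<forall>m n :: nat.
        1 \<le> n \<longrightarrow> 1 \<le> m \<longrightarrow> real m \<le> C * real n ^ J \<longrightarrow>
        (\<exists>\<epsilon> :: real. \<bar>\<epsilon>\<bar> \<le> K / real n \<and>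
           real (D m n) = fact (m * n) *
             exp (- real m / 2 + 1 / 2
                  + (\<Sum>j = 1..J. real_of_rat (\<gamma> j) * (real m / real n ^ j)) + \<epsilon>)))"
proof (intro exI[of _ acyclic_coeff] conjI allI impI computable_acyclic_coeff acyclic_coeff_values)
  fix J :: nat and C :: real
  define M where "M = nat \<lceil>\<bar>C\<bar> * 1000 ^ J\<rceil>"
  define K1 where "K1 = (\<Sum>j = 1..J. \<bar>real_of_rat (acyclic_coeff j)\<bar>)"
  define K2 where "K2 = 32262 + 2 * \<bar>C\<bar>"
  \<comment> \<open>For n < 1000 the growth condition forces m <= M, leaving finitely many pairs;
    the sum bounds them all. The absolute value of \<open>C\<close> is used since \<open>C\<close>
    may be negative.\<close>
  define K3 where "K3 = (\<Sum>(m, n)\<in>{..M} \<times> {..<1000}. real n * \<bar>log_error J m n\<bar>)"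
  have K: "0 \<le> K1" "0 \<le> K2" "0 \<le> K3"
    by (auto simp: K1_def K2_def K3_def intro!: sum_nonneg)
  have bound: "\<bar>log_error J m n\<bar> \<le> (K1 + K2 + K3) / real n"
    if "1 \<le> n" "1 \<le> m" "real m \<le> C * real n ^ J" for m n
  proof -
    have "real m \<le> \<bar>C\<bar> * real n ^ J"
      using that(3) by (rule order_trans) (intro mult_right_mono, auto)
    consider "m = 1" | "m \<ge> 2" "n \<ge> 1000" | "n < 1000" using \<open>1 \<le> m\<close> by linarith
    then have "\<bar>log_error J m n\<bar> \<le> K1 / real n \<or> \<bar>log_error J m n\<bar> \<le> K2 / real n \<or> \<bar>log_error J m n\<bar> \<le> K3 / real n"
    proof cases
      case 1
      then show ?thesis using abs_log_error_1[OF \<open>1 \<le> n\<close>] by (simp add: K1_def)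
    next
      case 2
      then show ?thesis
        using abs_log_error_large[of m "\<bar>C\<bar>" n J] \<open>real m \<le> \<bar>C\<bar> * real n ^ J\<close> by (simp add: K2_def)
    next
      case 3
      have "\<bar>C\<bar> * real n ^ J \<le> \<bar>C\<bar> * 1000 ^ J"
        using 3 by (intro mult_left_mono power_mono) auto
      then have "m \<le> M" unfolding M_def using \<open>real m \<le> \<bar>C\<bar> * real n ^ J\<close> by linarith
      then have "(case (m, n) of (m, n) \<Rightarrow> real n * \<bar>log_error J m n\<bar>) \<le> K3"
        unfolding K3_def using 3 by (intro member_le_sum) auto
      then show ?thesis using \<open>1 \<le> n\<close> by (simp add: pos_le_divide_eq mult.commute)
    qed
    moreover have "K1 / real n \<le> (K1 + K2 + K3) / real n" "K2 / real n \<le> (K1 + K2 + K3) / real n"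
        "K3 / real n \<le> (K1 + K2 + K3) / real n"
      using K by (intro divide_right_mono; simp)+
    ultimately show ?thesis by linarith
  qed
  show "\<exists>K :: real. \<forall>m n :: nat.
        1 \<le> n \<longrightarrow> 1 \<le> m \<longrightarrow> real m \<le> C * real n ^ J \<longrightarrow>
        (\<exists>\<epsilon> :: real. \<bar>\<epsilon>\<bar> \<le> K / real n \<and>
           real (D m n) = fact (m * n) *
             exp (- real m / 2 + 1 / 2
                  + (\<Sum>j = 1..J. real_of_rat (acyclic_coeff j) * (real m / real n ^ j)) + \<epsilon>))"
    using bound D_eq_exp_log_error by blast
qed

end
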